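(* Let $\Bbbk$ be a field, $X$ a finite set, and $\Sigma=(X,W,f)$ a terminating rewriting system on $\Bbbk\langle X\rangle$. Suppose that $(T(V),d)$ is a word-homogeneous acyclic extension of finite type of the Shafarevich complex $\mathrm{Sha}(W,\Bbbk\langle X\rangle)$. Then the rewriting system $\Sigma$ is convergent if and only if for each word-homogeneous element $c\in V_2$, the corresponding obstruction $S_c\in\Bbbk\langle X\rangle$ is mapped to zero by some reduction with respect to $\Sigma$.
   Context: **Rewriting.** $\langle X\rangle$ is the free monoid on $X$ (its elements are called monomials) and $\Bbbk\langle X\rangle$, its linear span, is the free unital associative algebra. For $g\in\Bbbk\langle X\rangle$, $\mathrm{supp}(g)$ is the set of monomials occurring in $g$ with non-zero coefficient. A rewriting system is a triple $\Sigma=(X,W,f)$ with $W\subset\langle X\rangle$ and $f\colon W\to\Bbbk\langle X\rangle$ a function. Put $R=\{w-f(w):w\in W\}$, $A_\Sigma=\Bbbk\langle X\rangle/(R)$ and $A_{\Sigma_0}=\Bbbk\langle X\rangle/(W)$. For $w\in W$, $a,b\in\langle X\rangle$, the basic reduction associated to $(a,w,b)$ is the linear endomorphism $\rho$ of $\Bbbk\langle X\rangle$ with $\rho(awb)=af(w)b$ and $\rho(m)=m$ for all other monomials $m$. A reduction is a finite sequence of basic reductions, acting on $\Bbbk\langle X\rangle$ by the composition of its terms. An element $g$ is irreducible if $\rho(g)=g$ for every basic reduction $\rho$. A normal form of $g$ is an irreducible element $\bar g$ with the same coset as $g$ in $A_\Sigma$. $\Sigma$ is terminating if for every $g$ and every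 infinite sequence $\rho_1,\rho_2,\ldots$ of basic reductions the sequence $\rho_1(g),\rho_2\rho_1(g),\rho_3\rho_2\rho_1(g),\ldots$ is eventually constant. Let $<_\Sigma$ be the smallest transitive relation on $\langle X\rangle$ such that $w'<_\Sigma w$ for all $w\in W$, $w'\in\mathrm{supp}(f(w))$, and such that $m<_\Sigma m'$ implies $amb<_\Sigma am'b$ for all $a,b\in\langle X\rangle$. Termination is identified with the property that $<_\Sigma$ is well-founded (every non-empty set of monomials has a $<_\Sigma$-minimal element; in particular $<_\Sigma$ is irreflexive), and this property is part of the standing assumption. A terminating $\Sigma$ is convergent if each $g\in\Bbbk\langle X\rangle$ has exactly one normal form. **Models.** Differential graded (dg) algebras are homologically graded with differential of degree $-1$ that is a graded derivation (Koszul sign rule). A quasi-free algebra is a dg algebra whose underlying graded algebra is a tensor algebra $T(V)$ on a graded vector space $V$; it is triangulated if there is a decomposition into graded subspaces $V=\bigoplus_{j\ge1}V^{(j)}$ such that for all $j\ge0$ the differential of each $v\in V^{(j+1)}$ lies in the subalgebra generated by $\bigoplus_{1\le k\le j}V^{(k)}$. A model of a dg algebra $A$ is a triangulated quasi-free algebra with a surjective quasi-isomorphism of dg algebras onto $A$; ordinary algebras are viewed as dg algebras concentrated in degree $0$ with zero differential. The Shafarevich complex $\mathrm{Sha}(W,\Bbbk\langle X\rangle)$ is the dg algebra $(T(V),d)$ with $V=V_0\oplus V_1$, $V_0=\Bbbk X$, $V_1$ having basis $\{e_w\}_{w\in W}$, and $d$ the derivation with $d(x)=0$ for $x\in X$ and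 $d(e_w)=w$. An acyclic extension of $\mathrm{Sha}(W,\Bbbk\langle X\rangle)$ is a model $(T(V),d)$ of $A_{\Sigma_0}=\Bbbk\langle X\rangle/(W)$ that is concentrated in non-negative homological degrees and in homological degrees zero and one is isomorphic to $\mathrm{Sha}(W,\Bbbk\langle X\rangle)$; so $V_0\cong\Bbbk X$, $V_1$ has basis $\{e_w\}_{w\in W}$, and $d(e_w)=w$. It is of finite type if $\dim V_n<\infty$ for all $n\ge0$. A dg algebra $(B,d)$ is word-homogeneous if $B=\bigoplus_{u\in\langle X\rangle}B_u$ as a direct sum of subcomplexes with $B_{u_1}B_{u_2}\subseteq B_{u_1u_2}$; elements of $B_u$ are word-homogeneous of grade $u$. The algebra $A_{\Sigma_0}$ is word-homogeneous in the obvious way. For a word-homogeneous acyclic extension $(T(V),d)$ of $\mathrm{Sha}(W,\Bbbk\langle X\rangle)$, the grading on $T(V)$ is induced from a grading by $\langle X\rangle$ on $V$, with each $x\in X$ of grade $x$ and each $e_w$ of grade $w$, and the map to $A_{\Sigma_0}$ preserves grades. **Obstructions.** For $c\in V_2$, the element $d(c)$ has homological degree $1$, hence is of the form $d(c)=\sum_i a_i e_{w_i} b_i\in T(V_0)\otimes V_1\otimes T(V_0)$ with $a_i,b_i\in T(V_0)\cong\Bbbk\langle X\rangle$, $w_i\in W$. The obstruction associated to $c$ is $S_c=\sum_i a_i f(w_i) b_i\in\Bbbk\langle X\rangle$. *)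

theory Defs
  imports
    "HOL-Library.Poly_Mapping"
    "HOL-Algebra.Module"
    "HOL-Algebra.QuotRing"
    "HOL-Algebra.Subrings"
begin

section \<open>Free algebras\<close>

text \<open>Monomials are lists; with concatenation as (non-commutative) addition of exponents, the
  convolution product of \<^type>\<open>poly_mapping\<close> is the product of the free associative algebra.\<close>

instantiation list :: (type) monoid_add
begin
definition zero_list :: "'a list" where "zero_list = []"
definition plus_list :: "'a list \<Rightarrow> 'a list \<Rightarrow> 'a list" where "plus_list = (@)"
instance by standard (simp_all add: zero_list_def plus_list_def)
end

type_synonym ('x, 'k) ncpoly = "'x list \<Rightarrow>\<^sub>0 'k"

abbreviation mon :: "'x list \<Rightarrow> ('x, 'k::field) ncpoly" where
  "mon m \<equiv> Poly_Mapping.single m 1"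

definition scale :: "'k::field \<Rightarrow> ('x, 'k) ncpoly \<Rightarrow> ('x, 'k) ncpoly" where
  "scale c = Poly_Mapping.map ((*) c)"

definition lin_ext :: "('x list \<Rightarrow> ('y, 'k::field) ncpoly) \<Rightarrow> ('x, 'k) ncpoly \<Rightarrow> ('y, 'k) ncpoly" where
  "lin_ext \<phi> g = (\<Sum>m\<in>Poly_Mapping.keys g. scale (Poly_Mapping.lookup g m) (\<phi> m))"

definition scalars :: "'k::field ring" where
  "scalars = \<lparr>carrier = UNIV, mult = (*), one = 1, zero = 0, add = (+)\<rparr>"

definition free_alg :: "'x set \<Rightarrow> ('k::field, ('x, 'k) ncpoly) module" where
  "free_alg X = \<lparr>carrier = {g. Poly_Mapping.keys g \<subseteq> lists X}, mult = (*), one = 1,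
                 zero = 0, add = (+), smult = scale\<rparr>"


section \<open>Rewriting systems\<close>

text \<open>Only the restriction of \<open>f\<close> to \<open>W\<close> matters.\<close>

definition rewriting_system ::
    "'x set \<Rightarrow> 'x list set \<Rightarrow> ('x list \<Rightarrow> ('x, 'k::field) ncpoly) \<Rightarrow> bool" where
  "rewriting_system X W f \<longleftrightarrow> W \<subseteq> lists X \<and> f \<in> W \<rightarrow> carrier (free_alg X)"

definition rewriting_ideal ::
    "'x set \<Rightarrow> 'x list set \<Rightarrow> ('x list \<Rightarrow> ('x, 'k::field) ncpoly) \<Rightarrow> ('x, 'k) ncpoly set" where
  "rewriting_ideal X W f = Idl\<^bsub>free_alg X\<^esub> {mon w - f w | w. w \<in> W}"

definition basic_reduction ::
    "('x list \<Rightarrow> ('x, 'k::field) ncpoly) \<Rightarrow> 'x list \<Rightarrow> 'x list \<Rightarrow> 'x list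
      \<Rightarrow> ('x, 'k) ncpoly \<Rightarrow> ('x, 'k) ncpoly" where
  "basic_reduction f a w b =
     lin_ext (\<lambda>m. if m = a @ w @ b then mon a * f w * mon b else mon m)"

definition basic_reductions ::
    "'x set \<Rightarrow> 'x list set \<Rightarrow> ('x list \<Rightarrow> ('x, 'k::field) ncpoly)
      \<Rightarrow> (('x, 'k) ncpoly \<Rightarrow> ('x, 'k) ncpoly) set" where
  "basic_reductions X W f =
     {basic_reduction f a w b | a w b. a \<in> lists X \<and> w \<in> W \<and> b \<in> lists X}"

text \<open>\<open>compose_seq [\<rho>\<^sub>1, \<dots>, \<rho>\<^sub>n] = \<rho>\<^sub>n \<circ> \<dots> \<circ> \<rho>\<^sub>1\<close>\<close>

definition compose_seq :: "('a \<Rightarrow> 'a) list \<Rightarrow> 'a \<Rightarrow> 'a" where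
  "compose_seq \<rho>s g = fold (\<lambda>\<rho> h. \<rho> h) \<rho>s g"

definition reductions ::
    "'x set \<Rightarrow> 'x list set \<Rightarrow> ('x list \<Rightarrow> ('x, 'k::field) ncpoly)
      \<Rightarrow> (('x, 'k) ncpoly \<Rightarrow> ('x, 'k) ncpoly) set" where
  "reductions X W f = compose_seq ` lists (basic_reductions X W f)"

definition irreducible_elt ::
    "'x set \<Rightarrow> 'x list set \<Rightarrow> ('x list \<Rightarrow> ('x, 'k::field) ncpoly) \<Rightarrow> ('x, 'k) ncpoly \<Rightarrow> bool" where
  "irreducible_elt X W f g \<longleftrightarrow> (\<forall>\<rho>\<in>basic_reductions X W f. \<rho> g = g)"

definition normal_form ::
    "'x set \<Rightarrow> 'x list set \<Rightarrow> ('x list \<Rightarrow> ('x, 'k::field) ncpoly)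
      \<Rightarrow> ('x, 'k) ncpoly \<Rightarrow> ('x, 'k) ncpoly \<Rightarrow> bool" where
  "normal_form X W f g h \<longleftrightarrow>
     h \<in> carrier (free_alg X) \<and> irreducible_elt X W f h \<and>
     rewriting_ideal X W f +>\<^bsub>free_alg X\<^esub> h = rewriting_ideal X W f +>\<^bsub>free_alg X\<^esub> g"

inductive mon_less ::
    "'x set \<Rightarrow> 'x list set \<Rightarrow> ('x list \<Rightarrow> ('x, 'k::field) ncpoly) \<Rightarrow> 'x list \<Rightarrow> 'x list \<Rightarrow> bool"
  for X W f where
  base: "w \<in> W \<Longrightarrow> w' \<in> Poly_Mapping.keys (f w) \<Longrightarrow> mon_less X W f w' w"
| chain: "mon_less X W f m m' \<Longrightarrow> mon_less X W f m' m'' \<Longrightarrow> mon_less X W f m m''"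
| ctxt: "mon_less X W f m m' \<Longrightarrow> a \<in> lists X \<Longrightarrow> b \<in> lists X
            \<Longrightarrow> mon_less X W f (a @ m @ b) (a @ m' @ b)"

text \<open>Termination comprises both the stabilisation of all sequences of basic reductions and the
  well-foundedness of the induced relation on monomials (which is assumed throughout).\<close>

definition terminating ::
    "'x set \<Rightarrow> 'x list set \<Rightarrow> ('x list \<Rightarrow> ('x, 'k::field) ncpoly) \<Rightarrow> bool" where
  "terminating X W f \<longleftrightarrow>
     (\<forall>g\<in>carrier (free_alg X). \<forall>\<rho> :: nat \<Rightarrow> _. range \<rho> \<subseteq> basic_reductions X W f \<longrightarrow>
        (\<exists>N. \<forall>n\<ge>N. compose_seq (map \<rho> [0..<n]) g = compose_seq (map \<rho> [0..<N]) g)) \<and>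
     wfp_on (lists X) (mon_less X W f)"

definition convergent_system ::
    "'x set \<Rightarrow> 'x list set \<Rightarrow> ('x list \<Rightarrow> ('x, 'k::field) ncpoly) \<Rightarrow> bool" where
  "convergent_system X W f \<longleftrightarrow>
     terminating X W f \<and> (\<forall>g\<in>carrier (free_alg X). \<exists>!h. normal_form X W f g h)"


section \<open>Differential graded algebras\<close>

record ('k, 'a) dga = "('k, 'a) module" +
  hcomp :: "int \<Rightarrow> 'a set"
  differential :: "'a \<Rightarrow> 'a"

definition linear_subspace :: "'a set \<Rightarrow> ('k::field, 'a, 'm) module_scheme \<Rightarrow> bool" where
  "linear_subspace S A \<longleftrightarrow> submodule S scalars A"

definition linear_map ::
    "('k::field, 'a, 'm) module_scheme \<Rightarrow> ('k, 'b, 'n) module_scheme \<Rightarrow> ('a \<Rightarrow> 'b) \<Rightarrow> bool" where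
  "linear_map A A' h \<longleftrightarrow>
     h \<in> carrier A \<rightarrow> carrier A' \<and>
     (\<forall>a\<in>carrier A. \<forall>b\<in>carrier A. h (a \<oplus>\<^bsub>A\<^esub> b) = h a \<oplus>\<^bsub>A'\<^esub> h b) \<and>
     (\<forall>c. \<forall>a\<in>carrier A. h (c \<odot>\<^bsub>A\<^esub> a) = c \<odot>\<^bsub>A'\<^esub> h a)"

definition assoc_algebra :: "('k::field, 'a, 'm) module_scheme \<Rightarrow> bool" where
  "assoc_algebra A \<longleftrightarrow>
     ring A \<and> module scalars A \<and>
     (\<forall>c. \<forall>a\<in>carrier A. \<forall>b\<in>carrier A.
        (c \<odot>\<^bsub>A\<^esub> a) \<otimes>\<^bsub>A\<^esub> b = c \<odot>\<^bsub>A\<^esub> (a \<otimes>\<^bsub>A\<^esub> b) \<and>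
        a \<otimes>\<^bsub>A\<^esub> (c \<odot>\<^bsub>A\<^esub> b) = c \<odot>\<^bsub>A\<^esub> (a \<otimes>\<^bsub>A\<^esub> b))"

definition internal_direct_sum ::
    "('k::field, 'a, 'm) module_scheme \<Rightarrow> 'a set \<Rightarrow> 'i set \<Rightarrow> ('i \<Rightarrow> 'a set) \<Rightarrow> bool" where
  "internal_direct_sum A U I C \<longleftrightarrow>
     linear_subspace U A \<and>
     (\<forall>i\<in>I. linear_subspace (C i) A \<and> C i \<subseteq> U) \<and>
     (\<forall>a\<in>U. \<exists>!s. (\<forall>i\<in>I. s i \<in> C i) \<and> (\<forall>i. i \<notin> I \<longrightarrow> s i = \<zero>\<^bsub>A\<^esub>) \<and>
                  finite {i. s i \<noteq> \<zero>\<^bsub>A\<^esub>} \<and> a = (\<Oplus>\<^bsub>A\<^esub>i\<in>{i. s i \<noteq> \<zero>\<^bsub>A\<^esub>}. s i))"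

definition graded_subspace :: "'a set \<Rightarrow> ('k::field, 'a, 'm) dga_scheme \<Rightarrow> bool" where
  "graded_subspace U A \<longleftrightarrow> internal_direct_sum A U UNIV (\<lambda>n. U \<inter> hcomp A n)"

definition dg_algebra :: "('k::field, 'a, 'm) dga_scheme \<Rightarrow> bool" where
  "dg_algebra A \<longleftrightarrow>
     assoc_algebra A \<and>
     internal_direct_sum A (carrier A) UNIV (hcomp A) \<and>
     \<one>\<^bsub>A\<^esub> \<in> hcomp A 0 \<and>
     (\<forall>m n. \<forall>a\<in>hcomp A m. \<forall>b\<in>hcomp A n. a \<otimes>\<^bsub>A\<^esub> b \<in> hcomp A (m + n)) \<and>
     linear_map A A (differential A) \<and>
     (\<forall>n. differential A ` hcomp A n \<subseteq> hcomp A (n - 1)) \<and>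
     (\<forall>a\<in>carrier A. differential A (differential A a) = \<zero>\<^bsub>A\<^esub>) \<and>
     (\<forall>m. \<forall>a\<in>hcomp A m. \<forall>b\<in>carrier A.
        differential A (a \<otimes>\<^bsub>A\<^esub> b) =
          differential A a \<otimes>\<^bsub>A\<^esub> b \<oplus>\<^bsub>A\<^esub>
          (if even m then a \<otimes>\<^bsub>A\<^esub> differential A b else \<ominus>\<^bsub>A\<^esub> (a \<otimes>\<^bsub>A\<^esub> differential A b)))"

definition dga_hom ::
    "('k::field, 'a, 'm) dga_scheme \<Rightarrow> ('k, 'b, 'n) dga_scheme \<Rightarrow> ('a \<Rightarrow> 'b) \<Rightarrow> bool" where
  "dga_hom A A' p \<longleftrightarrow>
     p \<in> ring_hom A A' \<and> linear_map A A' p \<and>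
     (\<forall>n. p ` hcomp A n \<subseteq> hcomp A' n) \<and>
     (\<forall>a\<in>carrier A. p (differential A a) = differential A' (p a))"

definition cycles :: "('k, 'a, 'm) dga_scheme \<Rightarrow> int \<Rightarrow> 'a set" where
  "cycles A n = {z \<in> hcomp A n. differential A z = \<zero>\<^bsub>A\<^esub>}"

definition boundaries :: "('k, 'a, 'm) dga_scheme \<Rightarrow> int \<Rightarrow> 'a set" where
  "boundaries A n = differential A ` hcomp A (n + 1)"

definition homology :: "('k, 'a, 'm) dga_scheme \<Rightarrow> int \<Rightarrow> 'a set set" where
  "homology A n = (\<lambda>z. boundaries A n +>\<^bsub>A\<^esub> z) ` cycles A n"

text \<open>The map induced by \<open>p\<close> on homology classes, with values in the homology of \<open>A'\<close>:
  the class of \<open>z\<close> goes to the class of \<open>p z\<close>.\<close>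

definition homology_map ::
    "('k, 'b, 'n) dga_scheme \<Rightarrow> ('a \<Rightarrow> 'b) \<Rightarrow> int \<Rightarrow> 'a set \<Rightarrow> 'b set" where
  "homology_map A' p n S = boundaries A' n <+>\<^bsub>A'\<^esub> p ` S"

definition quasi_isomorphism ::
    "('k::field, 'a, 'm) dga_scheme \<Rightarrow> ('k, 'b, 'n) dga_scheme \<Rightarrow> ('a \<Rightarrow> 'b) \<Rightarrow> bool" where
  "quasi_isomorphism A A' p \<longleftrightarrow>
     dga_hom A A' p \<and>
     (\<forall>n. bij_betw (homology_map A' p n) (homology A n) (homology A' n))"

text \<open>The quotient of an algebra by a two-sided ideal, as a dg algebra concentrated in degree \<open>0\<close>
  with zero differential.\<close>

definition quotient_dga :: "('k, 'a, 'm) module_scheme \<Rightarrow> 'a set \<Rightarrow> ('k, 'a set) dga" where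
  "quotient_dga A I =
     \<lparr>carrier = carrier (A Quot I), mult = mult (A Quot I), one = one (A Quot I),
      zero = zero (A Quot I), add = add (A Quot I),
      smult = (\<lambda>c S. \<Union>s\<in>S. I +>\<^bsub>A\<^esub> (c \<odot>\<^bsub>A\<^esub> s)),
      hcomp = (\<lambda>n. if n = 0 then carrier (A Quot I) else {zero (A Quot I)}),
      differential = (\<lambda>_. zero (A Quot I))\<rparr>"

definition subalgebra_generated ::
    "('k::field, 'a, 'm) module_scheme \<Rightarrow> 'a set \<Rightarrow> 'a set" where
  "subalgebra_generated A G = \<Inter>{S. linear_subspace S A \<and> subring S A \<and> G \<subseteq> S}"

text \<open>The word-grading of \<open>A\<close> is the family \<open>C\<close>; each \<open>C u\<close> is a subcomplex, i.e. a graded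
  subspace stable under the differential.\<close>

definition word_homogeneous ::
    "'x set \<Rightarrow> ('k::field, 'a, 'm) dga_scheme \<Rightarrow> ('x list \<Rightarrow> 'a set) \<Rightarrow> bool" where
  "word_homogeneous X A C \<longleftrightarrow>
     internal_direct_sum A (carrier A) (lists X) C \<and>
     (\<forall>u\<in>lists X. graded_subspace (C u) A \<and> differential A ` C u \<subseteq> C u) \<and>
     (\<forall>u\<in>lists X. \<forall>v\<in>lists X. \<forall>a\<in>C u. \<forall>b\<in>C v. a \<otimes>\<^bsub>A\<^esub> b \<in> C (u @ v))"


section \<open>Quasi-free algebras and models\<close>

text \<open>A graded vector space \<open>V\<close> is given by a homogeneous basis \<open>B\<close> with degrees \<open>hdeg\<close>; then
  \<open>T(V)\<close> is the free algebra on \<open>B\<close>, and \<open>V\<close> its subspace spanned by words of length one.\<close>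

definition tensor_dga ::
    "'b set \<Rightarrow> ('b \<Rightarrow> int) \<Rightarrow> (('b, 'k::field) ncpoly \<Rightarrow> ('b, 'k) ncpoly)
      \<Rightarrow> ('k, ('b, 'k) ncpoly) dga" where
  "tensor_dga B hdeg d =
     \<lparr>carrier = carrier (free_alg B), mult = (*), one = 1, zero = 0, add = (+), smult = scale,
      hcomp = (\<lambda>n. {g \<in> carrier (free_alg B).
                      \<forall>m\<in>Poly_Mapping.keys g. sum_list (map hdeg m) = n}),
      differential = d\<rparr>"

definition generator_space :: "'b set \<Rightarrow> ('b, 'k::field) ncpoly set" where
  "generator_space B = {g. Poly_Mapping.keys g \<subseteq> {[b] | b. b \<in> B}}"

abbreviation generator_comp :: "'b set \<Rightarrow> ('b \<Rightarrow> int) \<Rightarrow> int \<Rightarrow> ('b, 'k::field) ncpoly set" where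
  "generator_comp B hdeg n \<equiv> generator_space {b \<in> B. hdeg b = n}"

definition quasi_free ::
    "'b set \<Rightarrow> ('b \<Rightarrow> int) \<Rightarrow> (('b, 'k::field) ncpoly \<Rightarrow> ('b, 'k) ncpoly) \<Rightarrow> bool" where
  "quasi_free B hdeg d \<longleftrightarrow> dg_algebra (tensor_dga B hdeg d)"

text \<open>The summands of a triangulation are arbitrary graded subspaces of \<open>V\<close>; they need not be
  spanned by elements of \<open>B\<close>.\<close>

definition triangulated ::
    "'b set \<Rightarrow> ('b \<Rightarrow> int) \<Rightarrow> (('b, 'k::field) ncpoly \<Rightarrow> ('b, 'k) ncpoly) \<Rightarrow> bool" where
  "triangulated B hdeg d \<longleftrightarrow>
     (\<exists>V :: nat \<Rightarrow> ('b, 'k) ncpoly set.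
        internal_direct_sum (tensor_dga B hdeg d) (generator_space B) {1..} V \<and>
        (\<forall>j\<ge>1. graded_subspace (V j) (tensor_dga B hdeg d)) \<and>
        (\<forall>j. d ` V (j + 1) \<subseteq>
               subalgebra_generated (tensor_dga B hdeg d) (\<Union>k\<in>{1..j}. V k)))"

definition model ::
    "'b set \<Rightarrow> ('b \<Rightarrow> int) \<Rightarrow> (('b, 'k::field) ncpoly \<Rightarrow> ('b, 'k) ncpoly)
      \<Rightarrow> ('k, 'a, 'm) dga_scheme \<Rightarrow> (('b, 'k) ncpoly \<Rightarrow> 'a) \<Rightarrow> bool" where
  "model B hdeg d A p \<longleftrightarrow>
     quasi_free B hdeg d \<and> triangulated B hdeg d \<and>
     quasi_isomorphism (tensor_dga B hdeg d) A p \<and>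
     p ` carrier (tensor_dga B hdeg d) = carrier A"


section \<open>Acyclic extensions of the Shafarevich complex\<close>

definition monomial_algebra ::
    "'x set \<Rightarrow> 'x list set \<Rightarrow> ('k::field, ('x, 'k) ncpoly set) dga" where
  "monomial_algebra X W = quotient_dga (free_alg X) (Idl\<^bsub>free_alg X\<^esub> (mon ` W))"

text \<open>The derivation extending \<open>\<delta>\<close>, by the Koszul sign rule:
  \<open>b\<^sub>1\<dots>b\<^sub>n\<close> goes to the sum over \<open>i\<close> of \<open>\<plusminus> b\<^sub>1\<dots>b\<^bsub>i-1\<^esub> \<delta>(b\<^sub>i) b\<^bsub>i+1\<^esub>\<dots>b\<^sub>n\<close>.\<close>

definition derivation_ext ::
    "('b \<Rightarrow> int) \<Rightarrow> ('b \<Rightarrow> ('b, 'k::field) ncpoly) \<Rightarrow> ('b, 'k) ncpoly \<Rightarrow> ('b, 'k) ncpoly" where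
  "derivation_ext hdeg \<delta> =
     lin_ext (\<lambda>m. \<Sum>i<length m.
       scale (if even (sum_list (map hdeg (take i m))) then 1 else - 1)
         (mon (take i m) * \<delta> (m ! i) * mon (drop (Suc i) m)))"

text \<open>In the Shafarevich complex \<open>Inl x\<close> stands for \<open>x \<in> X\<close> and \<open>Inr w\<close> for \<open>e\<^sub>w\<close>.\<close>

definition sha_gens :: "'x set \<Rightarrow> 'x list set \<Rightarrow> ('x + 'x list) set" where
  "sha_gens X W = Inl ` X \<union> Inr ` W"

definition sha_deg :: "'x + 'x list \<Rightarrow> int" where
  "sha_deg = case_sum (\<lambda>_. 0) (\<lambda>_. 1)"

definition sha_diff :: "('x + 'x list, 'k::field) ncpoly \<Rightarrow> ('x + 'x list, 'k) ncpoly" where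
  "sha_diff = derivation_ext sha_deg (case_sum (\<lambda>_. 0) (\<lambda>w. mon (map Inl w)))"

definition sha :: "'x set \<Rightarrow> 'x list set \<Rightarrow> ('k::field, ('x + 'x list, 'k) ncpoly) dga" where
  "sha X W = tensor_dga (sha_gens X W) sha_deg sha_diff"

definition relabel :: "('a \<Rightarrow> 'b) \<Rightarrow> ('a, 'k::field) ncpoly \<Rightarrow> ('b, 'k) ncpoly" where
  "relabel \<iota> = lin_ext (\<lambda>m. mon (map \<iota> m))"

text \<open>The isomorphism with the Shafarevich complex in degrees \<open>0\<close> and \<open>1\<close> is induced by an
  identification \<open>\<iota>\<close> of its generators with the generators of \<open>T(V)\<close> of degree \<open>0\<close> and \<open>1\<close>;
  thus \<open>V\<^sub>0\<close> has basis \<open>\<iota> (Inl x)\<close> for \<open>x \<in> X\<close>, and \<open>V\<^sub>1\<close> has basis \<open>e\<^sub>w = \<iota> (Inr w)\<close> for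
  \<open>w \<in> W\<close>.\<close>

definition acyclic_extension ::
    "'x set \<Rightarrow> 'x list set \<Rightarrow> 'b set \<Rightarrow> ('b \<Rightarrow> int) \<Rightarrow> (('b, 'k::field) ncpoly \<Rightarrow> ('b, 'k) ncpoly)
      \<Rightarrow> ('x + 'x list \<Rightarrow> 'b) \<Rightarrow> (('b, 'k) ncpoly \<Rightarrow> ('x, 'k) ncpoly set) \<Rightarrow> bool" where
  "acyclic_extension X W B hdeg d \<iota> p \<longleftrightarrow>
     model B hdeg d (monomial_algebra X W) p \<and>
     (\<forall>n<0. hcomp (tensor_dga B hdeg d) n = {0}) \<and>
     bij_betw \<iota> (sha_gens X W) {b \<in> B. hdeg b \<in> {0, 1}} \<and>
     (\<forall>s\<in>sha_gens X W. hdeg (\<iota> s) = sha_deg s) \<and>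
     (\<forall>n\<in>{0, 1}. \<forall>z\<in>hcomp (sha X W) n.
        d (relabel \<iota> z) = relabel \<iota> (differential (sha X W) z))"

definition finite_type :: "'b set \<Rightarrow> ('b \<Rightarrow> int) \<Rightarrow> bool" where
  "finite_type B hdeg \<longleftrightarrow> (\<forall>n\<ge>0. finite {b \<in> B. hdeg b = n})"

text \<open>The word-grading of \<open>T(V)\<close> induced by a word-grading of \<open>V\<close>; here \<open>B\<close> is a basis homogeneous
  for both gradings of \<open>V\<close>.\<close>

definition word_comp ::
    "'b set \<Rightarrow> ('b \<Rightarrow> 'x list) \<Rightarrow> 'x list \<Rightarrow> ('b, 'k::field) ncpoly set" where
  "word_comp B gr u =
     {g \<in> carrier (free_alg B). \<forall>m\<in>Poly_Mapping.keys g. concat (map gr m) = u}"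

definition monomial_algebra_comp ::
    "'x set \<Rightarrow> 'x list set \<Rightarrow> 'x list \<Rightarrow> ('x, 'k::field) ncpoly set set" where
  "monomial_algebra_comp X W u =
     range (\<lambda>c. Idl\<^bsub>free_alg X\<^esub> (mon ` W) +>\<^bsub>free_alg X\<^esub> scale c (mon u))"

definition word_homogeneous_extension ::
    "'x set \<Rightarrow> 'x list set \<Rightarrow> 'b set \<Rightarrow> ('b \<Rightarrow> int) \<Rightarrow> (('b, 'k::field) ncpoly \<Rightarrow> ('b, 'k) ncpoly)
      \<Rightarrow> ('x + 'x list \<Rightarrow> 'b) \<Rightarrow> (('b, 'k) ncpoly \<Rightarrow> ('x, 'k) ncpoly set)
      \<Rightarrow> ('b \<Rightarrow> 'x list) \<Rightarrow> bool" where
  "word_homogeneous_extension X W B hdeg d \<iota> p gr \<longleftrightarrow>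
     acyclic_extension X W B hdeg d \<iota> p \<and>
     gr ` B \<subseteq> lists X \<and>
     (\<forall>x\<in>X. gr (\<iota> (Inl x)) = [x]) \<and> (\<forall>w\<in>W. gr (\<iota> (Inr w)) = w) \<and>
     word_homogeneous X (tensor_dga B hdeg d) (word_comp B gr) \<and>
     (\<forall>u\<in>lists X. p ` word_comp B gr u \<subseteq> monomial_algebra_comp X W u)"

text \<open>Replacing \<open>e\<^sub>w\<close> by \<open>f w\<close> in an element \<open>\<Sum>\<^sub>i a\<^sub>i e\<^bsub>w\<^sub>i\<^esub> b\<^sub>i\<close> of degree \<open>1\<close>: on such elements the
  algebra homomorphism below takes the value \<open>\<Sum>\<^sub>i a\<^sub>i f(w\<^sub>i) b\<^sub>i\<close>.\<close>

definition substitute_rules ::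
    "'x set \<Rightarrow> 'x list set \<Rightarrow> ('x list \<Rightarrow> ('x, 'k::field) ncpoly) \<Rightarrow> ('x + 'x list \<Rightarrow> 'b)
      \<Rightarrow> ('b, 'k) ncpoly \<Rightarrow> ('x, 'k) ncpoly" where
  "substitute_rules X W f \<iota> =
     lin_ext (\<lambda>m. prod_list
       (map (\<lambda>b. case_sum (\<lambda>x. mon [x]) f (inv_into (sha_gens X W) \<iota> b)) m))"

definition obstruction ::
    "'x set \<Rightarrow> 'x list set \<Rightarrow> ('x list \<Rightarrow> ('x, 'k::field) ncpoly) \<Rightarrow> ('x + 'x list \<Rightarrow> 'b)
      \<Rightarrow> (('b, 'k) ncpoly \<Rightarrow> ('b, 'k) ncpoly) \<Rightarrow> ('b, 'k) ncpoly \<Rightarrow> ('x, 'k) ncpoly" where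
  "obstruction X W f \<iota> d c = substitute_rules X W f \<iota> (d c)"

end

theory Submission
  imports Defs
begin

text \<open>Normal forms are unique as soon as any two one-step reducts of a word \<open>u\<close> differ by a
  combination of relations \<open>a (w - f w) b\<close> with \<open>a w b\<close> smaller than \<open>u\<close>. Two factorisations
  \<open>u = a w b = a' w' b'\<close> give a cycle \<open>z = a e\<^sub>w b - a' e\<^bsub>w'\<^esub> b'\<close> of degree \<open>1\<close> and grade \<open>u\<close>,
  and \<open>e\<^sub>w \<mapsto> f w\<close> sends it to the difference of the two reducts. By acyclicity \<open>z = d y\<close> with \<open>y\<close>
  of degree \<open>2\<close> and grade \<open>u\<close>, so it suffices to treat \<open>y\<close> a word: either it contains two
  generators of degree \<open>1\<close>, or it is \<open>a c b\<close> with \<open>c\<close> of degree \<open>2\<close> and gives \<open>a S\<^sub>c b\<close>.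
  Conversely, \<open>d (d c) = 0\<close> puts \<open>S\<^sub>c\<close> into the ideal of relations.\<close>

section \<open>Free algebras\<close>

lemma lookup_scale [simp]: "Poly_Mapping.lookup (scale c g) m = c * Poly_Mapping.lookup g m"
  by (simp add: scale_def Poly_Mapping.map.rep_eq when_def)

lemma scale_eq_mult: "scale c g = Poly_Mapping.single [] c * g"
  unfolding scale_def using mult_map_scale_conv_mult[of c g] by (simp add: zero_list_def)

lemma scale_zero [simp]: "scale c 0 = 0" "scale 0 g = 0"
  by (rule poly_mapping_eqI; simp)+

lemma scale_one [simp]: "scale 1 g = g"
  by (rule poly_mapping_eqI) simp

lemma scale_add: "scale c (g + h) = scale c g + scale c h"
  by (rule poly_mapping_eqI) (simp add: lookup_add algebra_simps)

lemma scale_diff: "scale c (g - h) = scale c g - scale c h"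
  by (rule poly_mapping_eqI) (simp add: lookup_minus algebra_simps)

lemma scale_add_left: "scale (b + c) g = scale b g + scale c g"
  by (rule poly_mapping_eqI) (simp add: lookup_add algebra_simps)

lemma scale_scale [simp]: "scale b (scale c g) = scale (b * c) g"
  by (rule poly_mapping_eqI) (simp add: algebra_simps)

lemma scale_uminus: "scale (- 1) g = - g"
  by (rule poly_mapping_eqI) simp

lemma scale_sum: "scale c (\<Sum>i\<in>I. g i) = (\<Sum>i\<in>I. scale c (g i))"
  by (induction I rule: infinite_finite_induct) (auto simp: scale_add)

lemma keys_scale: "Poly_Mapping.keys (scale c g) \<subseteq> Poly_Mapping.keys g"
  by (auto simp: in_keys_iff)

lemma mon_mult_mon [simp]: "mon a * mon b = mon (a @ b)"
  by (simp add: mult_single plus_list_def)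

lemma mon_Nil [simp]: "mon [] = 1"
  by (simp flip: single_one add: zero_list_def)

lemma mon_nonzero [simp]: "mon m \<noteq> 0"
  by (metis lookup_single_eq lookup_zero one_neq_zero)

lemma sum_monomials:
  assumes "finite S" "Poly_Mapping.keys g \<subseteq> S"
  shows "(\<Sum>m\<in>S. scale (Poly_Mapping.lookup g m) (mon m)) = g"
proof (rule poly_mapping_eqI)
  fix k
  have "(\<Sum>m\<in>S. Poly_Mapping.lookup g m * (1 when m = k))
      = (\<Sum>m\<in>S. if m = k then Poly_Mapping.lookup g m else 0)"
    by (rule sum.cong) (auto simp: when_def)
  also have "\<dots> = Poly_Mapping.lookup g k"
    using assms by (auto simp: sum.delta in_keys_iff)
  finally show "Poly_Mapping.lookup (\<Sum>m\<in>S. scale (Poly_Mapping.lookup g m) (mon m)) k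
      = Poly_Mapping.lookup g k"
    by (simp add: lookup_sum lookup_single)
qed

text \<open>Reduces linear claims to scaled monomials. The set \<open>S\<close> of admissible
  monomials is carried through the sum step because the differential of \<open>T(V)\<close> is known
  to be linear only on elements supported in \<open>lists B\<close>.\<close>

lemma ncpoly_induct [consumes 1, case_names zero mon add]:
  assumes "Poly_Mapping.keys g \<subseteq> S"
    and zero: "P 0"
    and mon: "\<And>c m. m \<in> S \<Longrightarrow> P (scale c (mon m))"
    and add: "\<And>g h. Poly_Mapping.keys g \<subseteq> S \<Longrightarrow> Poly_Mapping.keys h \<subseteq> S \<Longrightarrow> P g \<Longrightarrow> P h \<Longrightarrow> P (g + h)"
  shows "P g"
proof -
  let ?s = "\<lambda>T. \<Sum>m\<in>T. scale (Poly_Mapping.lookup g m) (mon m)"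
  have "Poly_Mapping.keys (?s T) \<subseteq> S \<and> P (?s T)" if "finite T" "T \<subseteq> S" for T
    using that
  proof (induction T)
    case (insert m T)
    have *: "Poly_Mapping.keys (scale (Poly_Mapping.lookup g m) (mon m)) \<subseteq> S"
      using keys_scale[of "Poly_Mapping.lookup g m" "mon m"] insert.prems by auto
    have "Poly_Mapping.keys (?s (insert m T)) \<subseteq> S"
      using insert * keys_add[of "scale (Poly_Mapping.lookup g m) (mon m)" "?s T"] by fastforce
    moreover have "P (?s (insert m T))"
      using insert * by (simp add: add mon)
    ultimately show ?case by blast
  qed (simp add: zero)
  from this[of "Poly_Mapping.keys g"] show ?thesis
    using assms(1) by (simp add: sum_monomials)
qed

lemma scale_mult_left: "scale c g * h = scale c (g * h)"
  by (simp add: scale_eq_mult mult.assoc)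

lemma scale_mult_right: "g * scale c h = scale c (g * h)"
proof -
  \<comment> \<open>Scalars are the multiples of the empty word; that they are central is checked on
    monomials.\<close>
  have "g * Poly_Mapping.single [] c = Poly_Mapping.single [] c * g"
    using subset_UNIV[of "Poly_Mapping.keys g"]
    by (induction g rule: ncpoly_induct)
      (auto simp: algebra_simps scale_eq_mult mult_single plus_list_def)
  then show ?thesis
    by (metis scale_eq_mult mult.assoc)
qed

lemma keys_mult_append:
  "Poly_Mapping.keys (g * h)
     \<subseteq> {a @ b | a b. a \<in> Poly_Mapping.keys g \<and> b \<in> Poly_Mapping.keys h}"
  using keys_mult[of g h] by (simp add: plus_list_def)

lemma keys_mon_mult_mon:
  "Poly_Mapping.keys (mon a * g * mon b) \<subseteq> (\<lambda>m. a @ m @ b) ` Poly_Mapping.keys g"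
  using keys_mult_append[of "mon a * g" "mon b"] keys_mult_append[of "mon a" g] by fastforce

text \<open>Coefficients outside the support vanish, so any finite superset can index the sum;
  additivity of \<open>lin_ext\<close> then uses one index set for \<open>g\<close>,
  \<open>h\<close> and \<open>g + h\<close>.\<close>

lemma lin_ext_eq_sum:
  assumes "finite S" "Poly_Mapping.keys g \<subseteq> S"
  shows "lin_ext \<phi> g = (\<Sum>m\<in>S. scale (Poly_Mapping.lookup g m) (\<phi> m))"
  unfolding lin_ext_def
  by (rule sum.mono_neutral_left) (use assms in \<open>auto simp: in_keys_iff\<close>)

lemma lin_ext_zero [simp]: "lin_ext \<phi> 0 = 0"
  by (simp add: lin_ext_def)

lemma lin_ext_mon [simp]: "lin_ext \<phi> (mon m) = \<phi> m"
  by (simp add: lin_ext_def)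

lemma lin_ext_add: "lin_ext \<phi> (g + h) = lin_ext \<phi> g + lin_ext \<phi> h"
proof -
  let ?S = "Poly_Mapping.keys g \<union> Poly_Mapping.keys h"
  have "lin_ext \<phi> k = (\<Sum>m\<in>?S. scale (Poly_Mapping.lookup k m) (\<phi> m))" if "k \<in> {g, h, g + h}" for k
    by (rule lin_ext_eq_sum) (use that keys_add[of g h] in auto)
  then show ?thesis
    by (simp add: lookup_add scale_add_left sum.distrib)
qed

lemma lin_ext_scale: "lin_ext \<phi> (scale c g) = scale c (lin_ext \<phi> g)"
proof -
  have "lin_ext \<phi> (scale c g)
      = (\<Sum>m\<in>Poly_Mapping.keys g. scale (Poly_Mapping.lookup (scale c g) m) (\<phi> m))"
    by (rule lin_ext_eq_sum) (simp_all add: keys_scale)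
  then show ?thesis
    by (simp add: lin_ext_def scale_sum)
qed

lemma lin_ext_diff: "lin_ext \<phi> (g - h) = lin_ext \<phi> g - lin_ext \<phi> h"
  using lin_ext_add[of \<phi> "g - h" h] by simp

lemma lin_ext_cong:
  "(\<And>m. m \<in> Poly_Mapping.keys g \<Longrightarrow> \<phi> m = \<psi> m) \<Longrightarrow> lin_ext \<phi> g = lin_ext \<psi> g"
  unfolding lin_ext_def by (rule sum.cong) auto

lemma lin_ext_mon_id: "lin_ext mon g = g"
  by (simp add: lin_ext_def sum_monomials)

section \<open>The free algebra as a ring\<close>

lemma free_alg_simps [simp]:
  "g \<in> carrier (free_alg X) \<longleftrightarrow> Poly_Mapping.keys g \<subseteq> lists X"
  "g \<otimes>\<^bsub>free_alg X\<^esub> h = g * h" "g \<oplus>\<^bsub>free_alg X\<^esub> h = g + h"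
  "\<one>\<^bsub>free_alg X\<^esub> = 1" "\<zero>\<^bsub>free_alg X\<^esub> = 0"
  by (simp_all add: free_alg_def)

lemma keys_mult_lists:
  "Poly_Mapping.keys g \<subseteq> lists X \<Longrightarrow> Poly_Mapping.keys h \<subseteq> lists X
     \<Longrightarrow> Poly_Mapping.keys (g * h) \<subseteq> lists X"
  using keys_mult_append[of g h] by fastforce

lemma ring_free_alg: "ring (free_alg X :: ('k::field, ('x, 'k) ncpoly) module)"
proof (rule ringI)
  show "abelian_group (free_alg X :: ('k, ('x, 'k) ncpoly) module)"
  proof (rule abelian_groupI)
    fix g h :: "('x, 'k) ncpoly"
    assume "g \<in> carrier (free_alg X)" "h \<in> carrier (free_alg X)"
    then show "g \<oplus>\<^bsub>free_alg X\<^esub> h \<in> carrier (free_alg X)"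
      unfolding free_alg_simps using keys_add[of g h] by blast
  next
    fix g :: "('x, 'k) ncpoly"
    assume "g \<in> carrier (free_alg X)"
    then show "\<exists>h\<in>carrier (free_alg X). h \<oplus>\<^bsub>free_alg X\<^esub> g = \<zero>\<^bsub>free_alg X\<^esub>"
      by (intro bexI[of _ "- g"]) simp_all
  qed (simp_all add: add_ac)
  show "Group.monoid (free_alg X :: ('k, ('x, 'k) ncpoly) module)"
  proof (rule monoidI)
    fix g h :: "('x, 'k) ncpoly"
    assume "g \<in> carrier (free_alg X)" "h \<in> carrier (free_alg X)"
    then show "g \<otimes>\<^bsub>free_alg X\<^esub> h \<in> carrier (free_alg X)"
      unfolding free_alg_simps by (rule keys_mult_lists)
  next
    show "\<one>\<^bsub>free_alg X\<^esub> \<in> carrier (free_alg X :: ('k, ('x, 'k) ncpoly) module)"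
      by (simp add: zero_list_def)
  qed (simp_all add: mult.assoc)
qed (simp_all add: algebra_simps)

lemma a_inv_free_alg:
  fixes g :: "('x, 'k::field) ncpoly"
  assumes "Poly_Mapping.keys g \<subseteq> lists X"
  shows "\<ominus>\<^bsub>free_alg X\<^esub> g = - g"
proof -
  interpret ring "free_alg X :: ('k, ('x, 'k) ncpoly) module" by (rule ring_free_alg)
  show ?thesis using minus_equality[of "- g" g] assms by simp
qed

section \<open>The span of the relations\<close>

text \<open>\<open>P\<close> bounds the words \<open>a @ w @ b\<close> at which relations are taken.
  With \<open>P\<close> always true this is the two-sided ideal of relations; with
  \<open>P v\<close> meaning that \<open>v\<close> lies below \<open>u\<close>, it is the space in
  which ambiguities at \<open>u\<close> have to be resolved.\<close>

inductive_set rel_span ::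
    "'x set \<Rightarrow> 'x list set \<Rightarrow> ('x list \<Rightarrow> ('x, 'k::field) ncpoly) \<Rightarrow> ('x list \<Rightarrow> bool)
      \<Rightarrow> ('x, 'k) ncpoly set"
  for X W f P where
  zero: "0 \<in> rel_span X W f P"
| step: "g \<in> rel_span X W f P \<Longrightarrow> a \<in> lists X \<Longrightarrow> w \<in> W \<Longrightarrow> b \<in> lists X \<Longrightarrow> P (a @ w @ b)
    \<Longrightarrow> g + scale c (mon a * (mon w - f w) * mon b) \<in> rel_span X W f P"

lemma rel_span_add:
  "h \<in> rel_span X W f P \<Longrightarrow> g \<in> rel_span X W f P \<Longrightarrow> g + h \<in> rel_span X W f P"
  by (induction rule: rel_span.induct) (auto simp: add.assoc[symmetric] intro: rel_span.step)

lemma rel_span_scale: "g \<in> rel_span X W f P \<Longrightarrow> scale c g \<in> rel_span X W f P"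
  by (induction rule: rel_span.induct) (auto simp: scale_add intro: rel_span.intros)

lemma rel_span_uminus: "g \<in> rel_span X W f P \<Longrightarrow> - g \<in> rel_span X W f P"
  using rel_span_scale[of g X W f P "- 1"] by (simp add: scale_uminus)

lemma rel_span_diff:
  "g \<in> rel_span X W f P \<Longrightarrow> h \<in> rel_span X W f P \<Longrightarrow> g - h \<in> rel_span X W f P"
  using rel_span_add[OF rel_span_uminus, of h X W f P g] by simp

lemma rel_span_generator:
  assumes "a \<in> lists X" "w \<in> W" "b \<in> lists X" "P (a @ w @ b)"
  shows "mon a * (mon w - f w) * mon b \<in> rel_span X W f P"
proof -
  have "0 + scale 1 (mon a * (mon w - f w) * mon b) \<in> rel_span X W f P"
    by (intro rel_span.step rel_span.zero assms)
  then show ?thesis by simp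
qed

text \<open>Multiplying by a monomial \<open>s\<close> only lengthens the left context from
  \<open>a\<close> to \<open>s @ a\<close>. Two bounds, \<open>P\<close> before and \<open>Q\<close>
  after, allow a strict bound to be carried into a larger context.\<close>

lemma rel_span_mult_left:
  assumes "Poly_Mapping.keys h \<subseteq> lists X" "g \<in> rel_span X W f P"
    and "\<And>s v. s \<in> Poly_Mapping.keys h \<Longrightarrow> P v \<Longrightarrow> Q (s @ v)"
  shows "h * g \<in> rel_span X W f Q"
proof -
  have "mon s * g \<in> rel_span X W f Q" if s: "s \<in> Poly_Mapping.keys h" for s
    using assms(2)
  proof (induction rule: rel_span.induct)
    case (step g a w b c)
    have "mon s * (mon a * (mon w - f w) * mon b) = mon (s @ a) * (mon w - f w) * mon b"
      by (simp flip: mon_mult_mon add: mult.assoc)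
    moreover have "s @ a \<in> lists X" "Q ((s @ a) @ w @ b)"
      using step assms(1,3) s by auto
    ultimately show ?case
      using step by (simp add: distrib_left scale_mult_right rel_span.step del: append_in_lists_conv)
  qed (simp add: rel_span.zero)
  \<comment> \<open>\<open>S\<close> stands for the support of \<open>h\<close> and stays fixed
    while \<open>h\<close> varies in the induction.\<close>
  moreover have "h * g \<in> rel_span X W f Q"
    if "Poly_Mapping.keys h \<subseteq> S" "\<And>s. s \<in> S \<Longrightarrow> mon s * g \<in> rel_span X W f Q" for S
    using that(1) by (induction h rule: ncpoly_induct)
      (auto simp: distrib_right scale_mult_left rel_span.zero rel_span_scale rel_span_add that(2))
  ultimately show ?thesis by blast
qed

lemma rel_span_mult_right:
  assumes "Poly_Mapping.keys h \<subseteq> lists X" "g \<in> rel_span X W f P"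
    and "\<And>s v. s \<in> Poly_Mapping.keys h \<Longrightarrow> P v \<Longrightarrow> Q (v @ s)"
  shows "g * h \<in> rel_span X W f Q"
proof -
  have "g * mon s \<in> rel_span X W f Q" if s: "s \<in> Poly_Mapping.keys h" for s
    using assms(2)
  proof (induction rule: rel_span.induct)
    case (step g a w b c)
    have "mon a * (mon w - f w) * mon b * mon s = mon a * (mon w - f w) * mon (b @ s)"
      by (simp flip: mon_mult_mon add: mult.assoc)
    moreover have "b @ s \<in> lists X" "Q (a @ w @ b @ s)"
      using step assms(1) assms(3)[OF s, of "a @ w @ b"] s by auto
    ultimately show ?case
      using step by (simp add: distrib_right scale_mult_left rel_span.step del: append_in_lists_conv)
  qed (simp add: rel_span.zero)
  moreover have "g * h \<in> rel_span X W f Q"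
    if "Poly_Mapping.keys h \<subseteq> S" "\<And>s. s \<in> S \<Longrightarrow> g * mon s \<in> rel_span X W f Q" for S
    using that(1) by (induction h rule: ncpoly_induct)
      (auto simp: distrib_left scale_mult_right rel_span.zero rel_span_scale rel_span_add that(2))
  ultimately show ?thesis by blast
qed

text \<open>Both sides are linear in \<open>g\<close> and agree on monomials. In this form a basic
  reduction visibly subtracts a multiple of a single relation.\<close>

lemma basic_reduction_eq:
  "basic_reduction f a w b g
     = g - scale (Poly_Mapping.lookup g (a @ w @ b)) (mon a * (mon w - f w) * mon b)"
proof -
  have "Poly_Mapping.keys g \<subseteq> UNIV" by simp
  then show ?thesis
  proof (induction g rule: ncpoly_induct)
    case (mon c m)
    have "mon a * (mon w - f w) * mon b = mon (a @ w @ b) - mon a * f w * mon b"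
      by (simp add: algebra_simps)
    then show ?case
      by (auto simp: basic_reduction_def lin_ext_scale lookup_single scale_diff when_def)
  next
    case (add g h)
    then show ?case
      by (simp add: basic_reduction_def lin_ext_add lookup_add scale_add_left)
  qed (simp add: basic_reduction_def)
qed

section \<open>The ideal of relations and the effect of reductions\<close>

locale rewriting =
  fixes X :: "'x set" and W :: "'x list set" and f :: "'x list \<Rightarrow> ('x, 'k::field) ncpoly"
  assumes rewriting_system: "rewriting_system X W f"
begin

abbreviation less (infix \<open>\<prec>\<close> 50) where "m \<prec> m' \<equiv> mon_less X W f m m'"

abbreviation relations where "relations \<equiv> rel_span X W f"

lemma W_lists: "w \<in> W \<Longrightarrow> w \<in> lists X"
  using rewriting_system unfolding rewriting_system_def by blast

lemma keys_f: "w \<in> W \<Longrightarrow> Poly_Mapping.keys (f w) \<subseteq> lists X"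
  using rewriting_system unfolding rewriting_system_def free_alg_simps(1)[symmetric]
  by (blast dest: funcset_mem)

lemma less_lists: "m \<prec> m' \<Longrightarrow> m \<in> lists X \<and> m' \<in> lists X"
proof (induction rule: mon_less.induct)
  case (base w w')
  then show ?case using W_lists keys_f by blast
qed auto

lemma less_append_left: "m \<prec> m' \<Longrightarrow> a \<in> lists X \<Longrightarrow> a @ m \<prec> a @ m'"
  using mon_less.ctxt[of X W f m m' a "[]"] by simp

lemma less_append_right: "m \<prec> m' \<Longrightarrow> b \<in> lists X \<Longrightarrow> m @ b \<prec> m' @ b"
  using mon_less.ctxt[of X W f m m' "[]" b] by simp

lemma keys_reduct_less:
  assumes "a \<in> lists X" "w \<in> W" "b \<in> lists X" "m \<in> Poly_Mapping.keys (mon a * f w * mon b)"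
  shows "m \<prec> a @ w @ b"
  using assms keys_mon_mult_mon[of a "f w" b] by (auto intro: mon_less.intros)

lemma keys_reduct_lists:
  assumes "a \<in> lists X" "w \<in> W" "b \<in> lists X"
  shows "Poly_Mapping.keys (mon a * f w * mon b) \<subseteq> lists X"
  using keys_reduct_less[OF assms] less_lists by blast

lemma keys_relation_lists:
  assumes "a \<in> lists X" "w \<in> W" "b \<in> lists X"
  shows "Poly_Mapping.keys (mon a * (mon w - f w) * mon b) \<subseteq> lists X"
proof -
  have *: "mon a * (mon w - f w) * mon b = mon (a @ w @ b) - mon a * f w * mon b"
    by (simp add: algebra_simps)
  have "Poly_Mapping.keys (mon (a @ w @ b) :: ('x, 'k) ncpoly) \<subseteq> lists X"
    using W_lists[OF assms(2)] assms by simp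
  then show ?thesis
    unfolding * by (intro order.trans[OF keys_diff] Un_least keys_reduct_lists[OF assms])
qed

lemma keys_relations: "g \<in> relations P \<Longrightarrow> Poly_Mapping.keys g \<subseteq> lists X"
proof (induction rule: rel_span.induct)
  case (step g a w b c)
  let ?r = "scale c (mon a * (mon w - f w) * mon b)"
  have "Poly_Mapping.keys ?r \<subseteq> lists X"
    using keys_relation_lists[of a w b] keys_scale[of c "mon a * (mon w - f w) * mon b"] step by blast
  then show ?case using step keys_add[of g ?r] by blast
qed simp

text \<open>The unbounded span absorbs products on both sides, hence is an ideal containing the
  generators; conversely the ideal generated by the \<open>w - f w\<close> contains each
  \<open>a (w - f w) b\<close>.\<close>

lemma rewriting_ideal_eq: "rewriting_ideal X W f = relations (\<lambda>_. True)"
proof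
  interpret A: ring "free_alg X :: ('k, ('x, 'k) ncpoly) module" by (rule ring_free_alg)
  have gens: "{mon w - f w |w. w \<in> W} \<subseteq> carrier (free_alg X)"
    using keys_relation_lists[of "[]" _ "[]"] by (auto simp del: in_lists_conv_set)
  have "ideal (relations (\<lambda>_. True)) (free_alg X)"
  proof (rule idealI[OF A.ring_axioms])
    show "subgroup (relations (\<lambda>_. True)) (add_monoid (free_alg X))"
    proof (rule A.add.subgroupI)
      show "relations (\<lambda>_. True) \<subseteq> carrier (free_alg X)"
        using keys_relations by auto
      show "relations (\<lambda>_. True) \<noteq> {}" using rel_span.zero by blast
      show "\<ominus>\<^bsub>free_alg X\<^esub> g \<in> relations (\<lambda>_. True)" if "g \<in> relations (\<lambda>_. True)" for g
        using that by (simp add: a_inv_free_alg keys_relations rel_span_uminus)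
    qed (simp add: rel_span_add)
  qed (simp_all add: rel_span_mult_left rel_span_mult_right)
  moreover have "{mon w - f w |w. w \<in> W} \<subseteq> relations (\<lambda>_. True)"
  proof clarify
    fix w assume "w \<in> W"
    then have "mon [] * (mon w - f w) * mon [] \<in> relations (\<lambda>_. True)"
      by (intro rel_span_generator) auto
    then show "mon w - f w \<in> relations (\<lambda>_. True)" by simp
  qed
  ultimately show "rewriting_ideal X W f \<subseteq> relations (\<lambda>_. True)"
    unfolding rewriting_ideal_def by (rule A.genideal_minimal)
  interpret I: ideal "rewriting_ideal X W f" "free_alg X"
    unfolding rewriting_ideal_def by (rule A.genideal_ideal[OF gens])
  have *: "mon w - f w \<in> rewriting_ideal X W f" if "w \<in> W" for w
    unfolding rewriting_ideal_def using A.genideal_self[OF gens] that by blast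
  show "relations (\<lambda>_. True) \<subseteq> rewriting_ideal X W f"
  proof
    fix g assume "g \<in> relations (\<lambda>_. True)"
    then show "g \<in> rewriting_ideal X W f"
    proof (induction rule: rel_span.induct)
      case zero
      then show ?case using I.zero_closed by simp
    next
      case (step g a w b c)
      have "mon a * (mon w - f w) \<in> rewriting_ideal X W f"
        using I.I_l_closed[OF *[of w], of "mon a"] step by simp
      \<comment> \<open>Ideals absorb ring elements, so the scalar \<open>c\<close> is moved into
        the right factor.\<close>
      then have "mon a * (mon w - f w) * scale c (mon b) \<in> rewriting_ideal X W f"
        using I.I_r_closed[of "mon a * (mon w - f w)" "scale c (mon b)"] keys_scale[of c "mon b"] step
        by (auto simp del: in_lists_conv_set)
      then show ?case
        using step I.a_closed[of g "scale c (mon a * (mon w - f w) * mon b)"]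
        by (simp add: scale_mult_right)
    qed
  qed
qed

lemma coset_eq_iff:
  assumes "Poly_Mapping.keys g \<subseteq> lists X" "Poly_Mapping.keys h \<subseteq> lists X"
  shows "rewriting_ideal X W f +>\<^bsub>free_alg X\<^esub> h = rewriting_ideal X W f +>\<^bsub>free_alg X\<^esub> g
    \<longleftrightarrow> h - g \<in> relations (\<lambda>_. True)"
proof -
  interpret A: ring "free_alg X :: ('k, ('x, 'k) ncpoly) module" by (rule ring_free_alg)
  have "{mon w - f w |w. w \<in> W} \<subseteq> carrier (free_alg X)"
    using keys_relation_lists[of "[]" _ "[]"] by (auto simp del: in_lists_conv_set)
  then have "ideal (rewriting_ideal X W f) (free_alg X)"
    unfolding rewriting_ideal_def by (rule A.genideal_ideal)
  from A.quotient_eq_iff_same_a_r_cos[OF this, of h g] assms show ?thesis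
    by (simp add: a_minus_def a_inv_free_alg rewriting_ideal_eq)
qed

text \<open>If the coefficient of \<open>a @ w @ b\<close> is zero, nothing happens. Otherwise that
  word occurs in \<open>g\<close> and satisfies \<open>P\<close>, and the new monomials lie below it
  and inherit \<open>P\<close> by \<open>down\<close>.\<close>

lemma basic_reduction_relations:
  assumes "\<rho> \<in> basic_reductions X W f" "\<forall>m\<in>Poly_Mapping.keys g. m \<in> lists X \<and> P m"
    and down: "\<And>v u. v \<prec> u \<Longrightarrow> P u \<Longrightarrow> P v"
  shows "g - \<rho> g \<in> relations P" "\<forall>m\<in>Poly_Mapping.keys (\<rho> g). m \<in> lists X \<and> P m"
proof -
  obtain a w b where awb: "\<rho> = basic_reduction f a w b" "a \<in> lists X" "w \<in> W" "b \<in> lists X"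
    using assms(1) unfolding basic_reductions_def by blast
  let ?c = "Poly_Mapping.lookup g (a @ w @ b)" and ?r = "mon a * (mon w - f w) * mon b"
  have \<rho>: "\<rho> g = g - scale ?c ?r"
    unfolding awb basic_reduction_eq ..
  consider "?c = 0" | "?c \<noteq> 0" "P (a @ w @ b)"
    using assms(2) by (auto simp: in_keys_iff)
  then have "g - \<rho> g \<in> relations P \<and> (\<forall>m\<in>Poly_Mapping.keys (\<rho> g). m \<in> lists X \<and> P m)"
  proof cases
    case 1
    then show ?thesis using \<rho> assms(2) by (simp add: rel_span.zero)
  next
    case 2
    have r: "?r = mon (a @ w @ b) - mon a * f w * mon b"
      by (simp add: algebra_simps)
    have "Poly_Mapping.keys (scale ?c ?r)
        \<subseteq> {a @ w @ b} \<union> Poly_Mapping.keys (mon a * f w * mon b)"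
      unfolding r using keys_scale keys_diff[of "mon (a @ w @ b)" "mon a * f w * mon b"]
      by (fastforce split: if_splits)
    moreover have "m \<in> lists X \<and> P m" if "m \<in> Poly_Mapping.keys (mon a * f w * mon b)" for m
      using keys_reduct_less[OF awb(2-4) that] down 2 less_lists by blast
    moreover have "a @ w @ b \<in> lists X"
      using awb W_lists by auto
    ultimately have "\<forall>m\<in>Poly_Mapping.keys (scale ?c ?r). m \<in> lists X \<and> P m"
      using 2 by blast
    then have "\<forall>m\<in>Poly_Mapping.keys (\<rho> g). m \<in> lists X \<and> P m"
      unfolding \<rho> using assms(2) keys_diff[of g "scale ?c ?r"] by blast
    moreover have "g - \<rho> g \<in> relations P"
      unfolding \<rho> using awb 2 by (simp add: rel_span_scale rel_span_generator)
    ultimately show ?thesis by blast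
  qed
  then show "g - \<rho> g \<in> relations P" "\<forall>m\<in>Poly_Mapping.keys (\<rho> g). m \<in> lists X \<and> P m"
    by blast+
qed

text \<open>The changes made by successive basic reductions telescope to
  \<open>g - \<rho> g\<close>. When \<open>\<rho> g = 0\<close>, this exhibits \<open>g\<close> as a
  combination of relations under the same bound as its monomials.\<close>

lemma reduction_relations:
  assumes "\<rho> \<in> reductions X W f" "\<forall>m\<in>Poly_Mapping.keys g. m \<in> lists X \<and> P m"
    and down: "\<And>v u. v \<prec> u \<Longrightarrow> P u \<Longrightarrow> P v"
  shows "g - \<rho> g \<in> relations P \<and> Poly_Mapping.keys (\<rho> g) \<subseteq> lists X"
proof -
  obtain \<rho>s where \<rho>s: "\<rho>s \<in> lists (basic_reductions X W f)" "\<rho> = compose_seq \<rho>s"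
    using assms(1) unfolding reductions_def by blast
  have "g - fold (\<lambda>\<rho>. \<rho>) \<rho>s g \<in> relations P
      \<and> Poly_Mapping.keys (fold (\<lambda>\<rho>. \<rho>) \<rho>s g) \<subseteq> lists X"
    using \<rho>s(1) assms(2)
  proof (induction \<rho>s arbitrary: g)
    case (Cons \<rho> \<rho>s)
    have *: "g - \<rho> g \<in> relations P" "\<forall>m\<in>Poly_Mapping.keys (\<rho> g). m \<in> lists X \<and> P m"
      by (rule basic_reduction_relations[OF Cons.hyps(1) Cons.prems]; fact down)+
    have "\<rho> g - fold (\<lambda>\<rho>. \<rho>) \<rho>s (\<rho> g) \<in> relations P
        \<and> Poly_Mapping.keys (fold (\<lambda>\<rho>. \<rho>) \<rho>s (\<rho> g)) \<subseteq> lists X"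
      by (rule Cons.IH[OF *(2)])
    then show ?case
      using rel_span_add[OF _ *(1), of "\<rho> g - fold (\<lambda>\<rho>. \<rho>) \<rho>s (\<rho> g)"] by simp
  qed (auto simp: rel_span.zero)
  then show ?thesis
    unfolding \<rho>s(2) compose_seq_def by simp
qed

definition reducible :: "'x list \<Rightarrow> bool" where
  "reducible u \<longleftrightarrow> (\<exists>a w b. a \<in> lists X \<and> w \<in> W \<and> b \<in> lists X \<and> u = a @ w @ b)"

end

section \<open>Termination, normal forms and the diamond lemma\<close>

locale terminating_rewriting = rewriting +
  assumes terminating: "terminating X W f"
begin

text \<open>Well-foundedness on \<open>lists X\<close> extends to all words, since the relation only
  connects words over \<open>X\<close>.\<close>

lemma wf_less: "wf {(v, u). v \<prec> u}"
  unfolding wf_def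
proof (intro allI impI)
  fix P x
  assume "\<forall>x. (\<forall>y. (y, x) \<in> {(v, u). v \<prec> u} \<longrightarrow> P y) \<longrightarrow> P x"
  then have step: "\<And>x. (\<And>y. y \<prec> x \<Longrightarrow> P y) \<Longrightarrow> P x" by simp
  have "wfp_on (lists X) (\<prec>)"
    using terminating unfolding terminating_def by blast
  moreover have "\<forall>x\<in>lists X. (\<forall>y\<in>lists X. y \<prec> x \<longrightarrow> P y) \<longrightarrow> P x"
    using step less_lists by metis
  ultimately have "\<forall>x\<in>lists X. P x"
    unfolding wfp_on_def by blast
  then show "P x"
    using step[of x] less_lists by metis
qed

lemma less_irrefl: "\<not> u \<prec> u"
  using wf_less by (metis (no_types) case_prodI mem_Collect_eq wf_not_refl)

text \<open>The relation for a factorisation of \<open>m\<close> has coefficient one at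
  \<open>m\<close>, because by irreflexivity \<open>m\<close> does not occur in its own reduct.
  Reducing there would thus cancel \<open>m\<close> from \<open>g\<close>.\<close>

lemma irreducible_eltD:
  assumes "irreducible_elt X W f g" "m \<in> Poly_Mapping.keys g"
  shows "\<not> reducible m"
proof
  assume "reducible m"
  then obtain a w b where awb: "a \<in> lists X" "w \<in> W" "b \<in> lists X" "m = a @ w @ b"
    unfolding reducible_def by blast
  then have "basic_reduction f a w b g = g"
    using assms(1) unfolding irreducible_elt_def basic_reductions_def by blast
  then have "scale (Poly_Mapping.lookup g m) (mon a * (mon w - f w) * mon b) = 0"
    unfolding basic_reduction_eq awb(4) by (simp add: algebra_simps)
  then have "Poly_Mapping.lookup (scale (Poly_Mapping.lookup g m) (mon a * (mon w - f w) * mon b)) m = 0"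
    by simp
  moreover have "mon a * (mon w - f w) * mon b = mon m - mon a * f w * mon b"
    by (simp add: algebra_simps awb)
  moreover have "Poly_Mapping.lookup (mon a * f w * mon b) m = 0"
    using keys_reduct_less[OF awb(1-3)] awb(4) less_irrefl by (auto simp: in_keys_iff)
  ultimately show False
    using assms(2) by (simp add: lookup_minus in_keys_iff)
qed

lemma irreducible_zero: "irreducible_elt X W f 0"
  unfolding irreducible_elt_def basic_reductions_def by (auto simp: basic_reduction_eq)

text \<open>Iterate a choice of basic reduction that changes every element which is not irreducible.
  Termination makes the resulting sequence stationary, and it can only stop at an irreducible
  element.\<close>

lemma ex_reduction_irreducible:
  assumes "Poly_Mapping.keys g \<subseteq> lists X"
  shows "\<exists>\<rho>\<in>reductions X W f. irreducible_elt X W f (\<rho> g)"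
proof (cases "irreducible_elt X W f g")
  case True
  have "compose_seq [] \<in> reductions X W f"
    unfolding reductions_def by blast
  moreover have "compose_seq [] g = g" by (simp add: compose_seq_def)
  ultimately show ?thesis using True by metis
next
  case False
  let ?B = "basic_reductions X W f"
  \<comment> \<open>Even at an irreducible element the choice must return some basic reduction, to
    keep the sequence infinite; one exists because \<open>g\<close> is not irreducible.\<close>
  from False have "\<exists>\<rho>. \<rho> \<in> ?B" unfolding irreducible_elt_def by blast
  then have "\<forall>h. \<exists>\<rho>. \<rho> \<in> ?B \<and> (\<not> irreducible_elt X W f h \<longrightarrow> \<rho> h \<noteq> h)"
    unfolding irreducible_elt_def by blast
  then obtain R where R: "\<And>h. R h \<in> ?B" "\<And>h. \<not> irreducible_elt X W f h \<Longrightarrow> R h h \<noteq> h"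
    by metis
  define G where "G = rec_nat g (\<lambda>_ h. R h h)"
  define \<rho> where "\<rho> n = R (G n)" for n
  have G: "compose_seq (map \<rho> [0..<n]) g = G n" for n
    by (induction n) (auto simp: compose_seq_def G_def \<rho>_def)
  have "range \<rho> \<subseteq> ?B" using R(1) \<rho>_def by auto
  moreover have "g \<in> carrier (free_alg X)" using assms by simp
  ultimately obtain N
    where "\<forall>n\<ge>N. compose_seq (map \<rho> [0..<n]) g = compose_seq (map \<rho> [0..<N]) g"
    using terminating unfolding terminating_def by meson
  then have "G (Suc N) = G N" unfolding G by (meson le_SucI order_refl)
  then have "irreducible_elt X W f (G N)"
    using R(2)[of "G N"] by (auto simp: G_def)
  moreover have "compose_seq (map \<rho> [0..<N]) \<in> reductions X W f"
    unfolding reductions_def using R(1) \<rho>_def by (intro imageI) auto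
  ultimately show ?thesis using G by metis
qed

lemma ex_normal_form:
  assumes "Poly_Mapping.keys g \<subseteq> lists X"
  shows "\<exists>\<rho>\<in>reductions X W f. normal_form X W f g (\<rho> g)"
proof -
  obtain \<rho> where \<rho>: "\<rho> \<in> reductions X W f" "irreducible_elt X W f (\<rho> g)"
    using ex_reduction_irreducible[OF assms] by blast
  then have *: "g - \<rho> g \<in> relations (\<lambda>_. True)" "Poly_Mapping.keys (\<rho> g) \<subseteq> lists X"
    using reduction_relations[of \<rho> g "\<lambda>_. True"] assms by blast+
  have "\<rho> g - g \<in> relations (\<lambda>_. True)"
    using rel_span_uminus[OF *(1)] by simp
  then show ?thesis
    using \<rho> coset_eq_iff[OF assms *(2)] *(2) unfolding normal_form_def by auto
qed

text \<open>Both \<open>0\<close> and a fully reduced form of \<open>g\<close> are normal forms of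
  \<open>g\<close>, so uniqueness identifies them.\<close>

lemma convergent_reduces_to_zero:
  assumes "convergent_system X W f" "g \<in> relations (\<lambda>_. True)"
  shows "\<exists>\<rho>\<in>reductions X W f. \<rho> g = 0"
proof -
  have g: "Poly_Mapping.keys g \<subseteq> lists X" using keys_relations[OF assms(2)] .
  then obtain \<rho> where \<rho>: "\<rho> \<in> reductions X W f" "normal_form X W f g (\<rho> g)"
    using ex_normal_form by blast
  have "0 - g \<in> relations (\<lambda>_. True)"
    using rel_span_uminus[OF assms(2)] by simp
  then have "normal_form X W f g 0"
    unfolding normal_form_def by (simp add: coset_eq_iff[OF g, of 0] irreducible_zero)
  moreover have "\<exists>!h. normal_form X W f g h"
    using assms(1) g by (simp add: convergent_system_def)
  ultimately have "\<rho> g = 0"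
    using \<rho>(2) by (metis (no_types))
  then show ?thesis using \<rho>(1) by blast
qed

text \<open>Normal forms are computed by fixing one factorisation \<open>u = a w b\<close> of each reducible
  word; confluence below every word makes the result independent of this choice.\<close>

lemma ex_normal_form_map:
  "\<exists>N. (\<forall>u. \<not> reducible u \<longrightarrow> N u = mon u) \<and>
     (\<forall>u. reducible u \<longrightarrow> (\<exists>a w b. a \<in> lists X \<and> w \<in> W \<and> b \<in> lists X \<and> u = a @ w @ b \<and>
        N u = lin_ext N (mon a * f w * mon b)))"
proof -
  have "\<forall>u. \<exists>a w b. reducible u \<longrightarrow> a \<in> lists X \<and> w \<in> W \<and> b \<in> lists X \<and> u = a @ w @ b"
    unfolding reducible_def by blast
  then obtain l m r where F: "\<And>u. reducible u \<Longrightarrow>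
      l u \<in> lists X \<and> m u \<in> W \<and> r u \<in> lists X \<and> u = l u @ m u @ r u"
    by metis
  define H where
    "H h u = (if reducible u then lin_ext h (mon (l u) * f (m u) * mon (r u)) else mon u)" for h u
  define N where "N = wfrec {(v, u). v \<prec> u} H"
  have N: "N u = H (cut N {(v, u). v \<prec> u} u) u" for u
    unfolding N_def by (rule wfrec[OF wf_less])
  have "N u = mon u" if "\<not> reducible u" for u
    unfolding N[of u] H_def using that by simp
  moreover have "\<exists>a w b. a \<in> lists X \<and> w \<in> W \<and> b \<in> lists X \<and> u = a @ w @ b \<and>
      N u = lin_ext N (mon a * f w * mon b)" if "reducible u" for u
  proof -
    note * = F[OF that]
    have "N u = lin_ext (cut N {(v, u). v \<prec> u} u) (mon (l u) * f (m u) * mon (r u))"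
      unfolding N[of u] H_def using that by simp
    \<comment> \<open>Well-founded recursion cuts \<open>N\<close> off to the words below
      \<open>u\<close>; nothing is lost, since every monomial of the reduct lies below
      \<open>u\<close>.\<close>
    also have "\<dots> = lin_ext N (mon (l u) * f (m u) * mon (r u))"
    proof (rule lin_ext_cong)
      fix v assume "v \<in> Poly_Mapping.keys (mon (l u) * f (m u) * mon (r u))"
      then have "v \<prec> u" using keys_reduct_less[of "l u" "m u" "r u" v] * by metis
      then show "cut N {(v, u). v \<prec> u} u v = N v" by (simp add: cut_def)
    qed
    finally show ?thesis using * by metis
  qed
  ultimately show ?thesis by blast
qed

text \<open>The linear extension of \<open>N\<close> annihilates the ideal and fixes irreducible
  elements. Two normal forms of \<open>g\<close> differ by an element of the ideal and therefore
  coincide.\<close>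

lemma diamond_lemma:
  assumes resolvable: "\<And>a w b a' w' b'. a \<in> lists X \<Longrightarrow> w \<in> W \<Longrightarrow> b \<in> lists X \<Longrightarrow> a' \<in> lists X
      \<Longrightarrow> w' \<in> W \<Longrightarrow> b' \<in> lists X \<Longrightarrow> a @ w @ b = a' @ w' @ b'
      \<Longrightarrow> mon a * f w * mon b - mon a' * f w' * mon b' \<in> relations (\<lambda>v. v \<prec> a @ w @ b)"
  shows "convergent_system X W f"
proof -
  obtain N where N_irr: "\<And>u. \<not> reducible u \<Longrightarrow> N u = mon u"
    and N_red: "\<And>u. reducible u \<Longrightarrow> \<exists>a w b. a \<in> lists X \<and> w \<in> W \<and> b \<in> lists X \<and>
       u = a @ w @ b \<and> N u = lin_ext N (mon a * f w * mon b)"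
    using ex_normal_form_map by blast
  have kill: "lin_ext N g = 0"
    if "g \<in> relations P" "\<And>a w b. a \<in> lists X \<Longrightarrow> w \<in> W \<Longrightarrow> b \<in> lists X \<Longrightarrow> P (a @ w @ b)
      \<Longrightarrow> lin_ext N (mon a * (mon w - f w) * mon b) = 0" for g P
    using that by (induction rule: rel_span.induct) (auto simp: lin_ext_add lin_ext_scale)
  have all: "\<forall>a w b. a \<in> lists X \<and> w \<in> W \<and> b \<in> lists X \<and> u = a @ w @ b
      \<longrightarrow> lin_ext N (mon a * (mon w - f w) * mon b) = 0" for u
  proof (induction u rule: wf_induct_rule[OF wf_less])
    case (1 u)
    show ?case
    proof (intro allI impI, elim conjE)
      fix a w b
      assume awb: "a \<in> lists X" "w \<in> W" "b \<in> lists X" "u = a @ w @ b"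
      then obtain a' w' b' where awb': "a' \<in> lists X" "w' \<in> W" "b' \<in> lists X" "u = a' @ w' @ b'"
          and Nu: "N u = lin_ext N (mon a' * f w' * mon b')"
        using N_red[of u] unfolding reducible_def by blast
      \<comment> \<open>The given factorisation is compared with the one that computes
        \<open>N u\<close>: their reducts differ by relations at smaller words, which
        \<open>N\<close> kills by the induction hypothesis.\<close>
      have "mon a' * f w' * mon b' - mon a * f w * mon b \<in> relations (\<lambda>v. v \<prec> u)"
        using resolvable[OF awb'(1-3) awb(1-3)] awb(4) awb'(4) by simp
      then have "lin_ext N (mon a' * f w' * mon b' - mon a * f w * mon b) = 0"
        by (rule kill) (use 1 in blast)
      moreover have "mon a * (mon w - f w) * mon b = mon u - mon a * f w * mon b"
        by (simp add: algebra_simps awb)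
      ultimately show "lin_ext N (mon a * (mon w - f w) * mon b) = 0"
        by (simp add: lin_ext_diff Nu)
    qed
  qed
  have N_rel: "lin_ext N g = 0" if "g \<in> relations (\<lambda>_. True)" for g
    by (rule kill[OF that]) (simp add: all)
  have N_fix: "lin_ext N h = h" if "irreducible_elt X W f h" for h
  proof -
    have "lin_ext N h = lin_ext mon h"
      using irreducible_eltD[OF that] N_irr by (intro lin_ext_cong) auto
    then show ?thesis by (simp add: lin_ext_mon_id)
  qed
  have "\<exists>!h. normal_form X W f g h" if "g \<in> carrier (free_alg X)" for g
  proof (rule ex_ex1I)
    show "\<exists>h. normal_form X W f g h"
      using ex_normal_form[of g] that by (simp only: free_alg_simps) blast
  next
    fix h k assume *: "normal_form X W f g h" "normal_form X W f g k"
    then have "h - k \<in> relations (\<lambda>_. True)"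
      using coset_eq_iff[of k h] unfolding normal_form_def by simp
    then have "lin_ext N (h - k) = 0"
      by (rule N_rel)
    then have "lin_ext N h = lin_ext N k"
      by (simp add: lin_ext_diff)
    then show "h = k"
      using * N_fix unfolding normal_form_def by simp
  qed
  then show ?thesis
    unfolding convergent_system_def using terminating by blast
qed

end

section \<open>Acyclic extensions\<close>

lemma substitute_rules_add:
  "substitute_rules X W f \<iota> (g + h) = substitute_rules X W f \<iota> g + substitute_rules X W f \<iota> h"
  by (simp add: substitute_rules_def lin_ext_add)

lemma substitute_rules_scale:
  "substitute_rules X W f \<iota> (scale c g) = scale c (substitute_rules X W f \<iota> g)"
  by (simp add: substitute_rules_def lin_ext_scale)

lemma substitute_rules_diff:
  "substitute_rules X W f \<iota> (g - h) = substitute_rules X W f \<iota> g - substitute_rules X W f \<iota> h"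
  by (simp add: substitute_rules_def lin_ext_diff)

lemma substitute_rules_zero [simp]: "substitute_rules X W f \<iota> 0 = 0"
  by (simp add: substitute_rules_def)

lemma substitute_rules_uminus: "substitute_rules X W f \<iota> (- g) = - substitute_rules X W f \<iota> g"
  using substitute_rules_diff[of X W f \<iota> 0 g] by simp

text \<open>On words the substitution is a product over letters, hence multiplicative; bilinearity
  extends this to all elements.\<close>

lemma substitute_rules_mult:
  "substitute_rules X W f \<iota> (g * h) = substitute_rules X W f \<iota> g * substitute_rules X W f \<iota> h"
proof -
  let ?\<psi> = "substitute_rules X W f \<iota>"
  have mon: "?\<psi> (mon m * mon n) = ?\<psi> (mon m) * ?\<psi> (mon n)" for m n
    by (simp add: substitute_rules_def)
  have left: "?\<psi> (mon m * h) = ?\<psi> (mon m) * ?\<psi> h" for m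
    using subset_UNIV[of "Poly_Mapping.keys h"]
    by (induction h rule: ncpoly_induct)
      (simp_all only: mult_zero_right substitute_rules_zero scale_mult_right substitute_rules_scale
        mon distrib_left substitute_rules_add)
  show ?thesis
    using subset_UNIV[of "Poly_Mapping.keys g"]
    by (induction g rule: ncpoly_induct)
      (simp_all only: mult_zero_left substitute_rules_zero scale_mult_left substitute_rules_scale
        left distrib_right substitute_rules_add)
qed

lemma tensor_dga_simps [simp]:
  "carrier (tensor_dga B hdeg d) = carrier (free_alg B)"
  "g \<otimes>\<^bsub>tensor_dga B hdeg d\<^esub> h = g * h" "g \<oplus>\<^bsub>tensor_dga B hdeg d\<^esub> h = g + h"
  "\<zero>\<^bsub>tensor_dga B hdeg d\<^esub> = 0" "c \<odot>\<^bsub>tensor_dga B hdeg d\<^esub> g = scale c g"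
  "differential (tensor_dga B hdeg d) = d"
  by (simp_all add: tensor_dga_def)

lemma hcomp_tensor_dga:
  "g \<in> hcomp (tensor_dga B hdeg d) n \<longleftrightarrow>
     (\<forall>m\<in>Poly_Mapping.keys g. m \<in> lists B \<and> sum_list (map hdeg m) = n)"
  by (auto simp: tensor_dga_def)

lemma word_comp_iff:
  "g \<in> word_comp B gr u \<longleftrightarrow>
     (\<forall>m\<in>Poly_Mapping.keys g. m \<in> lists B \<and> concat (map gr m) = u)"
  by (auto simp: word_comp_def)

text \<open>\<open>A'\<close> has at most one homology class in degree \<open>n\<close>, so by
  injectivity the class of \<open>z\<close> is that of \<open>0\<close>. As \<open>0\<close> is a
  boundary, \<open>z\<close> lies in its own coset and hence among the boundaries.\<close>

lemma homology_singleton_boundary: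
  fixes A :: "('k::field, 'a::monoid_add, 'm) dga_scheme"
  assumes quasi: "quasi_isomorphism A A' q" and one: "hcomp A' n \<subseteq> {a}"
    and zero: "0 \<in> cycles A n" "0 \<in> boundaries A n" and add: "\<And>x y. x \<oplus>\<^bsub>A\<^esub> y = x + y"
    and z: "z \<in> cycles A n"
  shows "z \<in> boundaries A (n::int)"
proof -
  have bij: "bij_betw (homology_map A' q n) (homology A n) (homology A' n)"
    using quasi unfolding quasi_isomorphism_def by simp
  have sub: "homology A' n \<subseteq> {boundaries A' n +>\<^bsub>A'\<^esub> a}"
    using one unfolding homology_def cycles_def by auto
  have in_hom: "boundaries A n +>\<^bsub>A\<^esub> y \<in> homology A n" if "y \<in> cycles A n" for y
    using that unfolding homology_def by (rule imageI)
  have "homology_map A' q n (boundaries A n +>\<^bsub>A\<^esub> z) = homology_map A' q n (boundaries A n +>\<^bsub>A\<^esub> 0)"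
    using bij_betw_apply[OF bij in_hom[OF z]] bij_betw_apply[OF bij in_hom[OF zero(1)]] sub by auto
  then have "boundaries A n +>\<^bsub>A\<^esub> z = boundaries A n +>\<^bsub>A\<^esub> 0"
    using bij_betw_imp_inj_on[OF bij] in_hom[OF z] in_hom[OF zero(1)] by (auto dest: inj_onD)
  moreover have "z \<in> boundaries A n +>\<^bsub>A\<^esub> z"
    using zero(2) unfolding a_r_coset_def' by (auto simp: add intro!: bexI[of _ 0])
  ultimately show ?thesis
    unfolding a_r_coset_def' by (auto simp: add)
qed

section \<open>The differential graded structure of \<open>T(V)\<close>\<close>

locale word_homogeneous_ext = terminating_rewriting X W f
  for X :: "'x set" and W :: "'x list set" and f :: "'x list \<Rightarrow> ('x, 'k::field) ncpoly" +
  fixes B :: "'b set" and hdeg :: "'b \<Rightarrow> int"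
    and d :: "('b, 'k) ncpoly \<Rightarrow> ('b, 'k) ncpoly"
    and \<iota> :: "'x + 'x list \<Rightarrow> 'b"
    and p :: "('b, 'k) ncpoly \<Rightarrow> ('x, 'k) ncpoly set"
    and gr :: "'b \<Rightarrow> 'x list"
  assumes extension: "word_homogeneous_extension X W B hdeg d \<iota> p gr"
begin

abbreviation "T \<equiv> tensor_dga B hdeg d"
abbreviation "\<psi> \<equiv> substitute_rules X W f \<iota>"
abbreviation "wdeg m \<equiv> sum_list (map hdeg m)"
abbreviation "grade m \<equiv> concat (map gr m)"
abbreviation "V0 \<equiv> map (\<lambda>x. \<iota> (Inl x))"
abbreviation "e w \<equiv> \<iota> (Inr w)"

lemma acyclic_extension: "acyclic_extension X W B hdeg d \<iota> p"
  using extension unfolding word_homogeneous_extension_def by simp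

lemma dg: "dg_algebra T"
  using acyclic_extension unfolding acyclic_extension_def model_def quasi_free_def by simp

lemma d_add:
  "Poly_Mapping.keys g \<subseteq> lists B \<Longrightarrow> Poly_Mapping.keys h \<subseteq> lists B \<Longrightarrow> d (g + h) = d g + d h"
  using dg unfolding dg_algebra_def linear_map_def by simp

lemma d_scale: "Poly_Mapping.keys g \<subseteq> lists B \<Longrightarrow> d (scale c g) = scale c (d g)"
  using dg unfolding dg_algebra_def linear_map_def by simp

lemma d_zero: "d 0 = 0"
  using d_scale[of 0 0] by simp

lemma d_diff:
  assumes "Poly_Mapping.keys g \<subseteq> lists B" "Poly_Mapping.keys h \<subseteq> lists B"
  shows "d (g - h) = d g - d h"
proof -
  have "Poly_Mapping.keys (g - h) \<subseteq> lists B"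
    by (intro order.trans[OF keys_diff] Un_least assms)
  from d_add[OF this assms(2)] show ?thesis by simp
qed

lemma d_d: "Poly_Mapping.keys g \<subseteq> lists B \<Longrightarrow> d (d g) = 0"
  using dg unfolding dg_algebra_def by simp

lemma d_hcomp: "g \<in> hcomp T n \<Longrightarrow> d g \<in> hcomp T (n - 1)"
  using dg unfolding dg_algebra_def by (simp add: image_subset_iff)

lemma hcomp_lists: "g \<in> hcomp T n \<Longrightarrow> Poly_Mapping.keys g \<subseteq> lists B"
  unfolding hcomp_tensor_dga by blast

lemma mon_hcomp: "m \<in> lists B \<Longrightarrow> mon m \<in> hcomp T (wdeg m)"
  unfolding hcomp_tensor_dga by simp

lemma leibniz:
  assumes g: "g \<in> hcomp T n" and h: "Poly_Mapping.keys h \<subseteq> lists B"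
  shows "d (g * h) = d g * h + (if even n then g * d h else - (g * d h))"
proof -
  interpret T: ring T
    using dg unfolding dg_algebra_def assoc_algebra_def by simp
  have "Poly_Mapping.keys (d h) \<subseteq> lists B"
    using dg h unfolding dg_algebra_def linear_map_def by (simp add: Pi_iff)
  then have "Poly_Mapping.keys (g * d h) \<subseteq> lists B"
    by (rule keys_mult_lists[OF hcomp_lists[OF g]])
  then have "\<ominus>\<^bsub>T\<^esub> (g * d h) = - (g * d h)"
    using T.minus_equality[of "- (g * d h)" "g * d h"] by simp
  moreover have "\<forall>m. \<forall>a\<in>hcomp T m. \<forall>b\<in>carrier T.
        differential T (a \<otimes>\<^bsub>T\<^esub> b) = differential T a \<otimes>\<^bsub>T\<^esub> b \<oplus>\<^bsub>T\<^esub>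
          (if even m then a \<otimes>\<^bsub>T\<^esub> differential T b else \<ominus>\<^bsub>T\<^esub> (a \<otimes>\<^bsub>T\<^esub> differential T b))"
    using dg unfolding dg_algebra_def by (elim conjE)
  then have "d (g * h) = d g * h + (if even n then g * d h else \<ominus>\<^bsub>T\<^esub> (g * d h))"
    using g h by simp
  ultimately show ?thesis by simp
qed

text \<open>Otherwise the word \<open>[b]\<close> would be a nonzero element of a vanishing
  component.\<close>

lemma hdeg_nonneg:
  assumes "b \<in> B" shows "0 \<le> hdeg b"
proof (rule ccontr)
  assume "\<not> 0 \<le> hdeg b"
  then have "hcomp T (hdeg b) = {0}"
    using acyclic_extension unfolding acyclic_extension_def by simp
  moreover have "mon [b] \<in> hcomp T (hdeg b)"
    using mon_hcomp[of "[b]"] assms by simp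
  ultimately show False using mon_nonzero by blast
qed

section \<open>Words of homological degree at most two\<close>

lemma deg_nonneg: "m \<in> lists B \<Longrightarrow> 0 \<le> wdeg m"
  by (induction m rule: lists.induct) (simp_all add: hdeg_nonneg)

lemma bij_\<iota>: "bij_betw \<iota> (sha_gens X W) {b \<in> B. hdeg b \<in> {0, 1}}"
  using acyclic_extension unfolding acyclic_extension_def by simp

lemma hdeg_\<iota>: "s \<in> sha_gens X W \<Longrightarrow> hdeg (\<iota> s) = sha_deg s"
  using acyclic_extension unfolding acyclic_extension_def by simp

lemma Inl_mem: "x \<in> X \<Longrightarrow> \<iota> (Inl x) \<in> B \<and> hdeg (\<iota> (Inl x)) = 0"
  using bij_betw_apply[OF bij_\<iota>, of "Inl x"] hdeg_\<iota>[of "Inl x"]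
  by (simp add: sha_gens_def sha_deg_def)

lemma e_mem: "w \<in> W \<Longrightarrow> e w \<in> B \<and> hdeg (e w) = 1"
  using bij_betw_apply[OF bij_\<iota>, of "Inr w"] hdeg_\<iota>[of "Inr w"]
  by (simp add: sha_gens_def sha_deg_def)

lemma hdeg_le_oneE:
  assumes "b \<in> B" "hdeg b \<in> {0, 1}"
  obtains x where "x \<in> X" "b = \<iota> (Inl x)" "hdeg b = 0" | w where "w \<in> W" "b = e w" "hdeg b = 1"
proof -
  have "b \<in> \<iota> ` sha_gens X W"
    using assms bij_betw_imp_surj_on[OF bij_\<iota>] by simp
  then show ?thesis
    using that Inl_mem e_mem unfolding sha_gens_def by blast
qed

lemma V0_mem: "a \<in> lists X \<Longrightarrow> V0 a \<in> lists B \<and> wdeg (V0 a) = 0 \<and> grade (V0 a) = a"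
proof (induction a rule: lists.induct)
  case (Cons x a)
  moreover have "gr (\<iota> (Inl x)) = [x]"
    using extension Cons.hyps(1) unfolding word_homogeneous_extension_def by simp
  ultimately show ?case using Inl_mem[of x] by simp
qed simp

lemma degree_zero_word:
  "m \<in> lists B \<Longrightarrow> wdeg m = 0 \<Longrightarrow> \<exists>a. a \<in> lists X \<and> m = V0 a"
proof (induction m rule: lists.induct)
  case (Cons b m)
  then have "hdeg b = 0" "wdeg m = 0"
    using hdeg_nonneg[of b] deg_nonneg[of m] by simp_all
  then obtain x a where "x \<in> X" "b = \<iota> (Inl x)" "a \<in> lists X" "m = V0 a"
    using Cons hdeg_le_oneE[of b] by (metis insertI1 zero_neq_one)
  then show ?case by (intro exI[of _ "x # a"]) simp
qed simp

lemma degree_one_word: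
  "m \<in> lists B \<Longrightarrow> wdeg m = 1 \<Longrightarrow>
     \<exists>a w b. a \<in> lists X \<and> w \<in> W \<and> b \<in> lists X \<and> m = V0 a @ e w # V0 b"
proof (induction m rule: lists.induct)
  case (Cons c m)
  then have "hdeg c \<in> {0, 1}"
    using hdeg_nonneg[of c] deg_nonneg[of m] by auto
  with \<open>c \<in> B\<close> show ?case
  proof (cases rule: hdeg_le_oneE)
    case (1 x)
    then obtain a w b where "a \<in> lists X" "w \<in> W" "b \<in> lists X" "m = V0 a @ e w # V0 b"
      using Cons by auto
    then show ?thesis using 1 by (intro exI[of _ "x # a"] exI[of _ w] exI[of _ b]) simp
  next
    case (2 w)
    then obtain b where "b \<in> lists X" "m = V0 b"
      using Cons degree_zero_word[of m] by auto
    then show ?thesis using 2 by (intro exI[of _ "[]"] exI[of _ w] exI[of _ b]) simp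
  qed
qed simp

text \<open>Letters have nonnegative degree, so the total two arises as 1 + 1 or from one letter of
  degree two. In the first case the letters of degree zero are shared out between \<open>m1\<close>
  and \<open>m2\<close>.\<close>

lemma degree_two_word:
  "m \<in> lists B \<Longrightarrow> wdeg m = 2 \<Longrightarrow>
     (\<exists>m1 m2. m = m1 @ m2 \<and> wdeg m1 = 1 \<and> wdeg m2 = 1) \<or>
     (\<exists>a c b. m = a @ c # b \<and> wdeg a = 0 \<and> hdeg c = 2 \<and> wdeg b = 0)"
proof (induction m rule: lists.induct)
  case (Cons c m)
  then consider "hdeg c = 0" "wdeg m = 2" | "hdeg c = 1" "wdeg m = 1" | "hdeg c = 2" "wdeg m = 0"
    using hdeg_nonneg[of c] deg_nonneg[of m] by force
  then show ?case
  proof cases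
    case 1
    from Cons.IH[OF 1(2)] show ?thesis
    proof (elim disjE exE conjE)
      fix m1 m2 assume "m = m1 @ m2" "wdeg m1 = 1" "wdeg m2 = 1"
      then show ?thesis
        using 1 by (intro disjI1 exI[of _ "c # m1"] exI[of _ m2]) simp
    next
      fix a c' b assume "m = a @ c' # b" "wdeg a = 0" "hdeg c' = 2" "wdeg b = 0"
      then show ?thesis
        using 1 by (intro disjI2 exI[of _ "c # a"] exI[of _ c'] exI[of _ b]) simp
    qed
  next
    case 2
    then show ?thesis by (intro disjI1 exI[of _ "[c]"] exI[of _ m]) simp
  next
    case 3
    then show ?thesis by (intro disjI2 exI[of _ "[]"] exI[of _ c] exI[of _ m]) simp
  qed
qed simp

section \<open>Differential and substitution in degrees zero and one\<close>

lemma d_sha: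
  "n \<in> {0, 1} \<Longrightarrow> z \<in> hcomp (sha X W) n \<Longrightarrow> d (relabel \<iota> z) = relabel \<iota> (sha_diff z)"
  using acyclic_extension unfolding acyclic_extension_def by (simp add: sha_def) blast

text \<open>The word is transported from the Shafarevich complex, whose derivation kills every
  letter \<open>Inl x\<close>.\<close>

lemma d_V0:
  assumes "a \<in> lists X" shows "d (mon (V0 a)) = 0"
proof -
  let ?z = "mon (map Inl a) :: ('x + 'x list, 'k) ncpoly"
  have "map Inl a \<in> lists (sha_gens X W)"
    using assms by (auto simp: sha_gens_def)
  moreover have "sum_list (map sha_deg (map Inl a)) = 0"
    by (induction a) (simp_all add: sha_deg_def)
  ultimately have "?z \<in> hcomp (sha X W) 0"
    by (simp add: sha_def hcomp_tensor_dga)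
  then have "d (relabel \<iota> ?z) = relabel \<iota> (sha_diff ?z)"
    by (intro d_sha[of 0]) simp_all
  moreover have "sha_diff ?z = 0"
    by (simp add: sha_diff_def derivation_ext_def)
  ultimately show ?thesis
    by (simp add: relabel_def comp_def)
qed

lemma d_e:
  assumes "w \<in> W" shows "d (mon [e w]) = mon (V0 w)"
proof -
  let ?z = "mon [Inr w] :: ('x + 'x list, 'k) ncpoly"
  have "?z \<in> hcomp (sha X W) 1"
    using assms by (simp add: sha_def hcomp_tensor_dga sha_gens_def sha_deg_def)
  then have "d (relabel \<iota> ?z) = relabel \<iota> (sha_diff ?z)"
    by (intro d_sha[of 1]) simp_all
  moreover have "sha_diff ?z = mon (map Inl w)"
    by (simp add: sha_diff_def derivation_ext_def)
  ultimately show ?thesis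
    by (simp add: relabel_def comp_def)
qed

text \<open>Words over \<open>X\<close> are cycles of degree zero, so only the term with
  \<open>d g\<close> survives in the Leibniz rule, and without a sign.\<close>

lemma d_context:
  assumes a: "a \<in> lists X" and b: "b \<in> lists X" and g: "g \<in> hcomp T n"
  shows "d (mon (V0 a) * g * mon (V0 b)) = mon (V0 a) * d g * mon (V0 b)"
proof -
  have keys: "Poly_Mapping.keys (mon (V0 b) :: ('b, 'k) ncpoly) \<subseteq> lists B"
    using V0_mem[OF b] by simp
  have "mon (V0 a) \<in> hcomp T 0"
    using mon_hcomp[of "V0 a"] V0_mem[OF a] by simp
  from leibniz[OF this keys_mult_lists[OF hcomp_lists[OF g] keys]]
  have "d (mon (V0 a) * (g * mon (V0 b))) = mon (V0 a) * d (g * mon (V0 b))"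
    by (simp add: d_V0[OF a])
  also have "d (g * mon (V0 b)) = d g * mon (V0 b)"
    using leibniz[OF g keys] by (simp add: d_V0[OF b])
  finally show ?thesis by (simp only: mult.assoc)
qed

lemma \<psi>_V0: "a \<in> lists X \<Longrightarrow> \<psi> (mon (V0 a)) = mon a"
proof (induction a rule: lists.induct)
  case Nil
  then show ?case by (simp add: substitute_rules_def flip: mon_Nil)
next
  case (Cons x a)
  have "inv_into (sha_gens X W) \<iota> (\<iota> (Inl x)) = Inl x"
    using bij_betw_imp_inj_on[OF bij_\<iota>] Cons.hyps(1) by (simp add: sha_gens_def)
  then have "\<psi> (mon [\<iota> (Inl x)]) = mon [x]"
    by (simp add: substitute_rules_def)
  moreover have "\<psi> (mon (V0 (x # a))) = \<psi> (mon [\<iota> (Inl x)] * mon (V0 a))" by simp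
  ultimately show ?case
    using Cons.IH by (simp add: substitute_rules_mult del: mon_mult_mon) simp
qed

lemma \<psi>_e:
  assumes "w \<in> W" shows "\<psi> (mon [e w]) = f w"
proof -
  have "inv_into (sha_gens X W) \<iota> (e w) = Inr w"
    using bij_betw_imp_inj_on[OF bij_\<iota>] assms by (simp add: sha_gens_def)
  then show ?thesis by (simp add: substitute_rules_def)
qed

text \<open>Such a word encodes the factorisation \<open>a @ w @ b\<close> with its middle factor
  marked: \<open>d\<close> forgets the marking, \<open>\<psi>\<close> rewrites the marked
  factor.\<close>

lemma degree_one_mon:
  assumes "a \<in> lists X" "w \<in> W" "b \<in> lists X"
  defines "m \<equiv> V0 a @ e w # V0 b"
  shows "m \<in> lists B" "wdeg m = 1" "grade m = a @ w @ b"
    "d (mon m) = mon (V0 (a @ w @ b))" "\<psi> (mon m) = mon a * f w * mon b"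
proof -
  have "gr (e w) = w"
    using extension assms(2) unfolding word_homogeneous_extension_def by simp
  then show "m \<in> lists B" "wdeg m = 1" "grade m = a @ w @ b"
    using V0_mem[OF assms(1)] V0_mem[OF assms(3)] e_mem[OF assms(2)] by (simp_all add: m_def)
  have m: "mon m = mon (V0 a) * mon [e w] * mon (V0 b)"
    by (simp add: m_def)
  have "mon [e w] \<in> hcomp T 1"
    using mon_hcomp[of "[e w]"] e_mem[OF assms(2)] by simp
  then show "d (mon m) = mon (V0 (a @ w @ b))"
    unfolding m using d_context[OF assms(1,3)] by (simp add: d_e[OF assms(2)] del: mon_mult_mon) simp
  show "\<psi> (mon m) = mon a * f w * mon b"
    unfolding m by (simp only: substitute_rules_mult \<psi>_V0[OF assms(1)] \<psi>_V0[OF assms(3)] \<psi>_e[OF assms(2)])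
qed

text \<open>For a word \<open>z\<close> with one marked factor, \<open>\<psi> (d z)\<close> is the
  unmarked word and \<open>\<psi> z\<close> its reduct, so the difference is a single
  relation.\<close>

lemma \<psi>_d_relations:
  assumes "z \<in> hcomp T 1"
  shows "\<psi> (d z) - \<psi> z \<in> relations (\<lambda>_. True)"
proof -
  have "Poly_Mapping.keys z \<subseteq> {m \<in> lists B. wdeg m = 1}"
    using assms unfolding hcomp_tensor_dga by blast
  then show ?thesis
  proof (induction z rule: ncpoly_induct)
    case zero
    then show ?case by (simp add: d_zero rel_span.zero)
  next
    case (mon c m)
    then have m: "m \<in> lists B" "wdeg m = 1" by simp_all
    then obtain a w b where awb: "a \<in> lists X" "w \<in> W" "b \<in> lists X" and mw: "m = V0 a @ e w # V0 b"
      using degree_one_word by metis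
    note eqs = degree_one_mon[OF awb, folded mw]
    have "a @ w @ b \<in> lists X" using awb W_lists by simp
    then have "\<psi> (d (mon m)) - \<psi> (mon m) = mon a * (mon w - f w) * mon b"
      unfolding eqs by (simp add: \<psi>_V0 algebra_simps del: map_append)
    moreover have "mon a * (mon w - f w) * mon b \<in> relations (\<lambda>_. True)"
      by (intro rel_span_generator awb TrueI)
    ultimately show ?case
      using m by (simp add: d_scale substitute_rules_scale rel_span_scale flip: scale_diff)
  next
    case (add g h)
    then have "d (g + h) = d g + d h" by (intro d_add) blast+
    then have "\<psi> (d (g + h)) - \<psi> (g + h) = (\<psi> (d g) - \<psi> g) + (\<psi> (d h) - \<psi> h)"
      by (simp add: substitute_rules_add)
    then show ?case using rel_span_add[OF add.IH(2,1)] by simp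
  qed
qed

lemma obstruction_relations:
  assumes "c \<in> hcomp T 2"
  shows "\<psi> (d c) \<in> relations (\<lambda>_. True)"
proof -
  have "d c \<in> hcomp T 1" using d_hcomp[OF assms] by simp
  \<comment> \<open>Taken at \<open>d c\<close>, whose own differential vanishes, the difference
    reduces to \<open>- \<psi> (d c)\<close>.\<close>
  from \<psi>_d_relations[OF this] have "- \<psi> (d c) \<in> relations (\<lambda>_. True)"
    using d_d[OF hcomp_lists[OF assms]] by simp
  from rel_span_uminus[OF this] show ?thesis by simp
qed

section \<open>Grades and boundaries\<close>

lemma d_word_comp:
  assumes "m \<in> lists B"
  shows "d (mon m) \<in> word_comp B gr (grade m)"
proof -
  have gr: "gr ` B \<subseteq> lists X"
    using extension unfolding word_homogeneous_extension_def by simp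
  have "grade m \<in> lists X"
    using assms gr by (induction m rule: lists.induct) auto
  then have "d ` word_comp B gr (grade m) \<subseteq> word_comp B gr (grade m)"
    using extension unfolding word_homogeneous_extension_def word_homogeneous_def by simp
  moreover have "mon m \<in> word_comp B gr (grade m)"
    using assms by (simp add: word_comp_iff)
  ultimately show ?thesis by blast
qed

text \<open>A word of degree one and grade \<open>u\<close> marks a rule inside \<open>u\<close>
  itself, so \<open>\<psi>\<close> turns it into a one-step reduct of \<open>u\<close>.\<close>

lemma keys_\<psi>_less:
  assumes "z \<in> hcomp T 1" "z \<in> word_comp B gr u"
  shows "\<forall>v\<in>Poly_Mapping.keys (\<psi> z). v \<in> lists X \<and> v \<prec> u"
proof -
  have "Poly_Mapping.keys z \<subseteq> {m \<in> lists B. wdeg m = 1 \<and> grade m = u}"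
    using assms unfolding hcomp_tensor_dga word_comp_iff by blast
  then show ?thesis
  proof (induction z rule: ncpoly_induct)
    case (mon c m)
    then obtain a w b where awb: "a \<in> lists X" "w \<in> W" "b \<in> lists X" and mw: "m = V0 a @ e w # V0 b"
      using degree_one_word by (metis (mono_tags, lifting) mem_Collect_eq)
    note eqs = degree_one_mon[OF awb, folded mw]
    have "Poly_Mapping.keys (\<psi> (scale c (mon m))) \<subseteq> Poly_Mapping.keys (mon a * f w * mon b)"
      unfolding substitute_rules_scale eqs by (rule keys_scale)
    moreover have "u = a @ w @ b" using mon eqs(3) by simp
    ultimately show ?case
      using keys_reduct_less[OF awb] less_lists by blast
  next
    case (add g h)
    then show ?case
      unfolding substitute_rules_add using keys_add[of "\<psi> g" "\<psi> h"] by blast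
  qed simp
qed

text \<open>The monomial algebra is concentrated in degree zero, so the quasi-isomorphism leaves no
  homology in degree one.\<close>

lemma degree_one_boundary:
  assumes "z \<in> hcomp T 1" "d z = 0"
  shows "\<exists>y\<in>hcomp T 2. d y = z"
proof -
  have "quasi_isomorphism T (monomial_algebra X W) p"
    using acyclic_extension unfolding acyclic_extension_def model_def by simp
  moreover have "hcomp (monomial_algebra X W :: ('k, ('x, 'k) ncpoly set) dga) 1
      \<subseteq> {\<zero>\<^bsub>free_alg X Quot Idl\<^bsub>free_alg X\<^esub> (mon ` W)\<^esub>}"
    by (simp add: monomial_algebra_def quotient_dga_def)
  moreover have zero: "0 \<in> hcomp T n" for n
    by (simp add: hcomp_tensor_dga)
  then have "0 \<in> cycles T 1" "0 \<in> boundaries T 1"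
    unfolding cycles_def boundaries_def using d_zero by (auto intro: image_eqI[OF _ zero])
  ultimately have "z \<in> boundaries T 1"
    by (rule homology_singleton_boundary) (use assms in \<open>simp_all add: cycles_def\<close>)
  then show ?thesis unfolding boundaries_def by auto
qed

text \<open>The two kinds of words of degree two give the trivial overlaps, resolved by reducing the
  two disjoint rules independently, and the obstructions.\<close>

lemma degree_two_relations:
  assumes obstructions: "\<And>c. c \<in> B \<Longrightarrow> hdeg c = 2 \<Longrightarrow> \<exists>\<rho>\<in>reductions X W f. \<rho> (\<psi> (d (mon [c]))) = 0"
    and m: "m \<in> lists B" "wdeg m = 2"
  shows "\<psi> (d (mon m)) \<in> relations (\<lambda>v. v \<prec> grade m)"
  using degree_two_word[OF m]
proof (elim disjE exE conjE)
  fix m1 m2 assume m12: "m = m1 @ m2" "wdeg m1 = 1" "wdeg m2 = 1"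
  then have B12: "m1 \<in> lists B" "m2 \<in> lists B" using m by simp_all
  obtain a1 w1 b1 where 1: "a1 \<in> lists X" "w1 \<in> W" "b1 \<in> lists X" and mw1: "m1 = V0 a1 @ e w1 # V0 b1"
    using degree_one_word[OF B12(1) m12(2)] by metis
  note eqs1 = degree_one_mon[OF 1, folded mw1]
  obtain a2 w2 b2 where 2: "a2 \<in> lists X" "w2 \<in> W" "b2 \<in> lists X" and mw2: "m2 = V0 a2 @ e w2 # V0 b2"
    using degree_one_word[OF B12(2) m12(3)] by metis
  note eqs2 = degree_one_mon[OF 2, folded mw2]
  let ?u1 = "a1 @ w1 @ b1" and ?u2 = "a2 @ w2 @ b2"
  let ?r1 = "mon a1 * (mon w1 - f w1) * mon b1" and ?r2 = "mon a2 * (mon w2 - f w2) * mon b2"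
  let ?f1 = "mon a1 * f w1 * mon b1" and ?f2 = "mon a2 * f w2 * mon b2"
  have u: "?u1 \<in> lists X" "?u2 \<in> lists X" using 1 2 W_lists by simp_all
  have "mon m1 \<in> hcomp T 1"
    using mon_hcomp[OF B12(1)] m12(2) by simp
  \<comment> \<open>The Koszul sign of \<open>m1\<close>, of odd degree, will produce a difference
    of two reducts of \<open>?u1 @ ?u2\<close>.\<close>
  then have "d (mon m1 * mon m2) = d (mon m1) * mon m2 + - (mon m1 * d (mon m2))"
    using leibniz[of "mon m1" 1 "mon m2"] B12(2) by (simp del: mon_mult_mon)
  moreover have "mon m = (mon m1 * mon m2 :: ('b, 'k) ncpoly)" by (simp add: m12(1))
  ultimately have "\<psi> (d (mon m)) = mon ?u1 * ?f2 - ?f1 * mon ?u2"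
    by (simp only: substitute_rules_add substitute_rules_uminus substitute_rules_mult eqs1 eqs2
        \<psi>_V0[OF u(1)] \<psi>_V0[OF u(2)] diff_conv_add_uminus)
  \<comment> \<open>Inserting \<open>?f1 * ?f2\<close> with both signs makes each summand a relation
    times a reduct of the other factor.\<close>
  also have "\<dots> = (mon ?u1 - ?f1) * ?f2 - ?f1 * (mon ?u2 - ?f2)"
    by (simp only: left_diff_distrib right_diff_distrib) simp
  also have "mon ?u1 - ?f1 = ?r1"
    by (simp add: algebra_simps)
  also have "mon ?u2 - ?f2 = ?r2"
    by (simp add: algebra_simps)
  finally have "\<psi> (d (mon m)) = ?r1 * ?f2 - ?f1 * ?r2" .
  \<comment> \<open>Each relation sits at exactly one word; multiplying by the strictly smaller
    monomials of the other reduct moves it strictly below \<open>?u1 @ ?u2\<close>.\<close>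
  moreover have "?r1 \<in> relations (\<lambda>v. v = ?u1)" "?r2 \<in> relations (\<lambda>v. v = ?u2)"
    by (intro rel_span_generator 1 2 refl)+
  then have "?r1 * ?f2 \<in> relations (\<lambda>v. v \<prec> ?u1 @ ?u2)" "?f1 * ?r2 \<in> relations (\<lambda>v. v \<prec> ?u1 @ ?u2)"
    using keys_reduct_less[OF 1] keys_reduct_less[OF 2] u
    by (auto intro!: rel_span_mult_right[OF keys_reduct_lists[OF 2]]
        rel_span_mult_left[OF keys_reduct_lists[OF 1]] less_append_left less_append_right
        simp del: append_assoc)
  moreover have "grade m = ?u1 @ ?u2"
    unfolding m12(1) by (simp add: eqs1 eqs2)
  ultimately show ?thesis using rel_span_diff by metis
next
  fix a c b assume acb: "m = a @ c # b" "wdeg a = 0" "hdeg c = 2" "wdeg b = 0"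
  then have "a \<in> lists B" "c \<in> B" "b \<in> lists B" using m by simp_all
  then obtain a' b' where a': "a' \<in> lists X" "a = V0 a'" and b': "b' \<in> lists X" "b = V0 b'"
    using acb degree_zero_word by metis
  have c: "mon [c] \<in> hcomp T 2"
    using mon_hcomp[of "[c]"] acb \<open>c \<in> B\<close> by simp
  let ?S = "\<psi> (d (mon [c]))"
  have "d (mon [c]) \<in> hcomp T 1" using d_hcomp[OF c] by simp
  moreover have "d (mon [c]) \<in> word_comp B gr (gr c)"
    using d_word_comp[of "[c]"] \<open>c \<in> B\<close> by simp
  ultimately have keys: "\<forall>v\<in>Poly_Mapping.keys ?S. v \<in> lists X \<and> v \<prec> gr c"
    by (rule keys_\<psi>_less)
  obtain \<rho> where "\<rho> \<in> reductions X W f" "\<rho> ?S = 0"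
    using obstructions[OF \<open>c \<in> B\<close> acb(3)] by blast
  \<comment> \<open>Since \<open>\<rho> ?S = 0\<close>, the difference treated by
    \<open>reduction_relations\<close> is \<open>?S\<close> itself; its bound is downward closed by
    transitivity.\<close>
  then have S: "?S \<in> relations (\<lambda>v. v \<prec> gr c)"
    using reduction_relations[OF _ keys, of \<rho>] mon_less.chain by force
  have aS: "mon a' * ?S \<in> relations (\<lambda>v. v \<prec> a' @ gr c)"
    by (rule rel_span_mult_left[OF _ S])
      (use a'(1) in \<open>simp_all add: less_append_left del: in_lists_conv_set\<close>)
  have "mon a' * ?S * mon b' \<in> relations (\<lambda>v. v \<prec> (a' @ gr c) @ b')"
    by (rule rel_span_mult_right[OF _ aS])
      (use b'(1) in \<open>simp_all add: less_append_right del: in_lists_conv_set append_assoc\<close>)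
  moreover have "mon m = (mon (V0 a') * mon [c] * mon (V0 b') :: ('b, 'k) ncpoly)"
    unfolding acb(1) a' b' by simp
  then have "\<psi> (d (mon m)) = mon a' * ?S * mon b'"
    by (simp only: d_context[OF a'(1) b'(1) c] substitute_rules_mult \<psi>_V0[OF a'(1)] \<psi>_V0[OF b'(1)])
  moreover have "grade m = (a' @ gr c) @ b'"
    unfolding acb(1) a' b' using V0_mem[OF a'(1)] V0_mem[OF b'(1)] by simp
  ultimately show ?thesis by simp
qed

text \<open>Acyclicity yields a preimage \<open>y\<close> of degree two without control of its
  grade. Projecting the boundary \<open>d y\<close> to grade \<open>u\<close> takes the place of
  choosing \<open>y\<close> homogeneous.\<close>

definition proj :: "'x list \<Rightarrow> ('b, 'k) ncpoly \<Rightarrow> ('b, 'k) ncpoly" where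
  "proj u = lin_ext (\<lambda>m. if grade m = u then mon m else 0)"

lemma proj_word_comp:
  assumes "g \<in> word_comp B gr v" shows "proj u g = (if u = v then g else 0)"
proof -
  have "proj u g = lin_ext (\<lambda>m. if u = v then mon m else 0) g"
    unfolding proj_def by (rule lin_ext_cong) (use assms in \<open>auto simp: word_comp_iff\<close>)
  then show ?thesis
    by (simp add: lin_ext_mon_id) (simp add: lin_ext_def)
qed

text \<open>As \<open>d\<close> preserves grades, the projection keeps the boundary of a word of
  grade \<open>u\<close> and discards that of any other word; linearity does the rest.\<close>

lemma boundary_proj_relations:
  assumes obstructions: "\<And>c. c \<in> B \<Longrightarrow> hdeg c = 2 \<Longrightarrow> \<exists>\<rho>\<in>reductions X W f. \<rho> (\<psi> (d (mon [c]))) = 0"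
    and "y \<in> hcomp T 2"
  shows "\<psi> (proj u (d y)) \<in> relations (\<lambda>v. v \<prec> u)"
proof -
  have "Poly_Mapping.keys y \<subseteq> {m \<in> lists B. wdeg m = 2}"
    using assms unfolding hcomp_tensor_dga by blast
  then show ?thesis
  proof (induction y rule: ncpoly_induct)
    case zero
    then show ?case by (simp add: d_zero proj_def rel_span.zero)
  next
    case (mon c m)
    then have m: "m \<in> lists B" "wdeg m = 2" by simp_all
    have "\<psi> (proj u (d (mon m))) \<in> relations (\<lambda>v. v \<prec> u)"
      unfolding proj_word_comp[OF d_word_comp[OF m(1)]]
      using degree_two_relations[OF obstructions m] by (simp add: rel_span.zero)
    then show ?case
      using m by (simp add: d_scale proj_def lin_ext_scale substitute_rules_scale rel_span_scale)
  next
    case (add g h)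
    then have "d (g + h) = d g + d h" by (intro d_add) blast+
    then have "\<psi> (proj u (d (g + h))) = \<psi> (proj u (d g)) + \<psi> (proj u (d h))"
      by (simp add: proj_def lin_ext_add substitute_rules_add)
    then show ?case using rel_span_add[OF add.IH(2,1)] by simp
  qed
qed

lemma obstructions_imp_convergent:
  assumes obstructions: "\<And>c. c \<in> B \<Longrightarrow> hdeg c = 2 \<Longrightarrow> \<exists>\<rho>\<in>reductions X W f. \<rho> (\<psi> (d (mon [c]))) = 0"
  shows "convergent_system X W f"
proof (rule diamond_lemma)
  fix a w b a' w' b'
  assume 1: "a \<in> lists X" "w \<in> W" "b \<in> lists X" and 2: "a' \<in> lists X" "w' \<in> W" "b' \<in> lists X"
    and u: "a @ w @ b = a' @ w' @ b'"
  let ?m = "V0 a @ e w # V0 b" and ?m' = "V0 a' @ e w' # V0 b'"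
  let ?z = "mon ?m - mon ?m' :: ('b, 'k) ncpoly"
  note eqs = degree_one_mon[OF 1] and eqs' = degree_one_mon[OF 2]
  have keys: "Poly_Mapping.keys ?z \<subseteq> {?m, ?m'}"
    using keys_diff[of "mon ?m" "mon ?m'"] by simp blast
  have "\<forall>m\<in>{?m, ?m'}. m \<in> lists B \<and> wdeg m = 1 \<and> grade m = a @ w @ b"
    using eqs(1-3) eqs'(1-3) u by (simp del: append_in_lists_conv)
  then have "?z \<in> hcomp T 1" and grade: "?z \<in> word_comp B gr (a @ w @ b)"
    unfolding hcomp_tensor_dga word_comp_iff using keys by blast+
  moreover have "d ?z = d (mon ?m) - d (mon ?m')"
    by (rule d_diff) (use eqs(1) eqs'(1) in \<open>simp_all del: append_in_lists_conv\<close>)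
  \<comment> \<open>\<open>?m\<close> and \<open>?m'\<close> mark two factors of the same word, and
    \<open>d\<close> forgets the markings.\<close>
  then have "d ?z = 0"
    unfolding eqs(4) eqs'(4) u by simp
  ultimately obtain y where y: "y \<in> hcomp T 2" "d y = ?z"
    using degree_one_boundary by blast
  \<comment> \<open>The boundary \<open>d y = ?z\<close> already has grade \<open>a @ w @ b\<close>,
    so the projection fixes it.\<close>
  have "\<psi> ?z \<in> relations (\<lambda>v. v \<prec> a @ w @ b)"
    using boundary_proj_relations[OF obstructions y(1), of "a @ w @ b"]
    unfolding y(2) proj_word_comp[OF grade] by simp
  then show "mon a * f w * mon b - mon a' * f w' * mon b' \<in> relations (\<lambda>v. v \<prec> a @ w @ b)"
    by (simp only: substitute_rules_diff eqs(5) eqs'(5))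
qed

end

theorem theorem5p2:
  fixes X :: "'x set" and W :: "'x list set"
    and f :: "'x list \<Rightarrow> ('x, 'k::field) ncpoly"
    and B :: "'b set" and hdeg :: "'b \<Rightarrow> int"
    and d :: "('b, 'k) ncpoly \<Rightarrow> ('b, 'k) ncpoly"
    and \<iota> :: "'x + 'x list \<Rightarrow> 'b"
    and p :: "('b, 'k) ncpoly \<Rightarrow> ('x, 'k) ncpoly set"
    and gr :: "'b \<Rightarrow> 'x list"
  assumes "finite X"
    and "rewriting_system X W f"
    and "terminating X W f"
    and "word_homogeneous_extension X W B hdeg d \<iota> p gr"
    and "finite_type B hdeg"
  shows "convergent_system X W f \<longleftrightarrow>
    (\<forall>c\<in>generator_comp B hdeg 2. (\<exists>u\<in>lists X. c \<in> word_comp B gr u) \<longrightarrow>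
       (\<exists>\<rho>\<in>reductions X W f. \<rho> (obstruction X W f \<iota> d c) = 0))"
    (is "_ \<longleftrightarrow> ?obstructions")
proof -
  interpret word_homogeneous_ext X W f B hdeg d \<iota> p gr
    using assms by unfold_locales
  show ?thesis
  proof
    assume conv: "convergent_system X W f"
    show ?obstructions
    proof (intro ballI impI)
      fix c :: "('b, 'k) ncpoly" assume "c \<in> generator_comp B hdeg 2"
      then have "c \<in> hcomp T 2"
        unfolding generator_space_def hcomp_tensor_dga by fastforce
      then show "\<exists>\<rho>\<in>reductions X W f. \<rho> (obstruction X W f \<iota> d c) = 0"
        unfolding obstruction_def
        by (intro convergent_reduces_to_zero[OF conv] obstruction_relations)
    qed
  next
    assume *: ?obstructions
    show "convergent_system X W f"
    proof (rule obstructions_imp_convergent)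
      fix c assume c: "c \<in> B" "hdeg c = 2"
      \<comment> \<open>The obstructions of basis elements suffice: the basis is homogeneous for
        both gradings, with \<open>[c]\<close> of grade \<open>gr c\<close>.\<close>
      then have "mon [c] \<in> generator_comp B hdeg 2" "mon [c] \<in> word_comp B gr (gr c)"
        by (simp_all add: generator_space_def word_comp_iff)
      moreover have "gr c \<in> lists X"
        using assms(4) c(1) unfolding word_homogeneous_extension_def by blast
      ultimately show "\<exists>\<rho>\<in>reductions X W f. \<rho> (\<psi> (d (mon [c]))) = 0"
        using * unfolding obstruction_def by blast
    qed
  qed
qed

end
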